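(* Let $P$ be the graph on five vertices obtained from the cycle $C_4$ by adding a new vertex and making it adjacent to exactly one vertex of the $C_4$. Then 4-COLORING can be solved in polynomial time for $(P_6,P)$-free graphs: there is a polynomial-time algorithm that, given a finite graph $G$ containing no induced subgraph isomorphic to $P_6$ and no induced subgraph isomorphic to $P$, decides whether $G$ is 4-colorable.
   Context: Graphs are finite, simple and undirected. $P_t$ and $C_t$ denote the path and the cycle on $t$ vertices, respectively. A graph is $(H_1,H_2)$-free if it contains neither $H_1$ nor $H_2$ as an induced subgraph. A $k$-coloring of a graph $G=(V,E)$ is a mapping $\phi:V\to\{1,2,\ldots,k\}$ such that $\phi(u)\neq\phi(v)$ whenever $uv\in E$; $G$ is $k$-colorable if it has a $k$-coloring. For fixed $k$, the decision problem $k$-COLORING asks whether an input graph is $k$-colorable. *)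

theory Defs
  imports
    "Graph_Theory.Pair_Digraph"
    "Graph_Theory.Digraph_Isomorphism"
    "HOL-Computational_Algebra.Polynomial"
begin

section \<open>Graphs, induced subgraphs and colorings\<close>

text \<open>
  A finite simple undirected graph is a record satisfying the locale predicate
  \<open>pair_graph\<close>: finite, loopless, and with a symmetric set of arcs. An edge \<open>uv\<close> is represented
  by the two arcs \<open>(u, v)\<close> and \<open>(v, u)\<close>.
\<close>

definition induced_free ::
  "'b pair_pre_digraph \<Rightarrow> 'a pair_pre_digraph \<Rightarrow> bool" where
  "induced_free H G \<longleftrightarrow>
     \<not> (\<exists>K. induced_subgraph K (with_proj G) \<and> digraph_iso K (with_proj H))"

lemma induced_free_iff_no_embedding:
  assumes "pair_graph G" "pair_graph H"
  shows "induced_free H G \<longleftrightarrow>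
    \<not> (\<exists>f. inj_on f (pverts H) \<and> f ` pverts H \<subseteq> pverts G \<and>
         (\<forall>u \<in> pverts H. \<forall>v \<in> pverts H. (u, v) \<in> parcs H \<longleftrightarrow> (f u, f v) \<in> parcs G))"
    (is "_ \<longleftrightarrow> \<not> ?emb")
proof -
  interpret G: pair_graph G by fact
  interpret H: pair_graph H by fact
  have ?emb if K: "induced_subgraph K (with_proj G)" and iso: "digraph_iso K (with_proj H)" for K
  proof -
    from K have tK: "tail K = fst" "head K = snd" and vK: "verts K \<subseteq> pverts G"
      and aK: "arcs K = {e \<in> parcs G. fst e \<in> verts K \<and> snd e \<in> verts K}"
      by (auto simp: induced_subgraph_def subgraph_def compatible_def)
    from iso obtain h where h: "pre_digraph.digraph_isomorphism K h" "with_proj H = app_iso h K"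
      by (auto simp: digraph_iso_def)
    from h(2) have hv: "pverts H = iso_verts h ` verts K" and ha: "parcs H = iso_arcs h ` arcs K"
      and ht: "iso_tail h = fst" "iso_head h = snd"
      by (metis with_proj_simps(1) verts_app_iso, metis with_proj_simps(2) arcs_app_iso,
          metis with_proj_simps(4) tail_app_iso, metis with_proj_simps(5) head_app_iso)
    from h(1) have inj: "inj_on (iso_verts h) (verts K)"
      and arc: "\<And>a. a \<in> arcs K \<Longrightarrow> iso_arcs h a = (iso_verts h (fst a), iso_verts h (snd a))"
      by (auto simp: pre_digraph.digraph_isomorphism_def tK ht intro: prod_eqI)
    have adj: "(iso_verts h u, iso_verts h v) \<in> parcs H \<longleftrightarrow> (u, v) \<in> parcs G"
      if "u \<in> verts K" "v \<in> verts K" for u v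
    proof
      assume "(iso_verts h u, iso_verts h v) \<in> parcs H"
      then obtain a where a: "a \<in> arcs K" "iso_verts h u = iso_verts h (fst a)"
        "iso_verts h v = iso_verts h (snd a)"
        unfolding ha using arc by auto
      with aK that inj have "u = fst a" "v = snd a" by (auto dest: inj_onD)
      with a(1) aK show "(u, v) \<in> parcs G" by auto
    next
      assume "(u, v) \<in> parcs G"
      with that aK have "(u, v) \<in> arcs K" by auto
      then show "(iso_verts h u, iso_verts h v) \<in> parcs H" unfolding ha using arc by force
    qed
    let ?f = "the_inv_into (verts K) (iso_verts h)"
    have "inj_on ?f (pverts H)" unfolding hv by (rule inj_on_the_inv_into[OF inj])
    moreover have "?f ` pverts H \<subseteq> pverts G"
      unfolding hv using the_inv_into_f_f[OF inj] vK by auto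
    moreover have "(u, v) \<in> parcs H \<longleftrightarrow> (?f u, ?f v) \<in> parcs G"
      if "u \<in> pverts H" "v \<in> pverts H" for u v
      using that unfolding hv by (auto simp: the_inv_into_f_f[OF inj] adj)
    ultimately show ?emb by blast
  qed
  moreover have "\<exists>K. induced_subgraph K (with_proj G) \<and> digraph_iso K (with_proj H)" if ?emb
  proof -
    from that obtain f where inj: "inj_on f (pverts H)" and sub: "f ` pverts H \<subseteq> pverts G"
      and adj: "\<And>u v. u \<in> pverts H \<Longrightarrow> v \<in> pverts H \<Longrightarrow> (u, v) \<in> parcs H \<longleftrightarrow> (f u, f v) \<in> parcs G"
      by blast
    define K where "K = \<lparr> pverts = f ` pverts H,
      parcs = {e \<in> parcs G. fst e \<in> f ` pverts H \<and> snd e \<in> f ` pverts H} \<rparr>"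
    interpret K: pair_wf_digraph K by unfold_locales (auto simp: K_def)
    have ind: "induced_subgraph (with_proj K) (with_proj G)"
      unfolding induced_subgraph_def subgraph_def compatible_def
      using sub K.wf_digraph G.wf_digraph by (auto simp: K_def)
    have parcs: "parcs K = map_prod f f ` parcs H"
    proof (intro set_eqI iffI)
      fix e assume "e \<in> parcs K"
      then obtain u v where "u \<in> pverts H" "v \<in> pverts H" "e = (f u, f v)" "(f u, f v) \<in> parcs G"
        by (cases e) (auto simp: K_def)
      then show "e \<in> map_prod f f ` parcs H" using adj by force
    next
      fix e assume "e \<in> map_prod f f ` parcs H"
      then obtain u v where e: "e = (f u, f v)" and uv: "(u, v) \<in> parcs H" by auto
      from uv have "u \<in> pverts H" "v \<in> pverts H" by (auto dest: H.in_arcsD1 H.in_arcsD2)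
      with e uv adj show "e \<in> parcs K" by (simp add: K_def)
    qed
    define h where "h = \<lparr> iso_verts = f, iso_arcs = map_prod f f, iso_head = snd, iso_tail = fst \<rparr>"
    have "inj_on (map_prod f f) (parcs H)"
    proof (rule inj_on_subset[OF map_prod_inj_on[OF inj inj]])
      show "parcs H \<subseteq> pverts H \<times> pverts H" using H.in_arcsD1 H.in_arcsD2 by auto
    qed
    then have iso: "pre_digraph.digraph_isomorphism (with_proj H) h"
      using inj H.wf_digraph by (simp add: pre_digraph.digraph_isomorphism_def h_def)
    have app: "with_proj K = app_iso h (with_proj H)"
      using parcs by (simp add: app_iso_def h_def with_proj_def K_def)
    from iso app have "digraph_iso (with_proj H) (with_proj K)"
      unfolding digraph_iso_def by blast
    then have "digraph_iso (with_proj K) (with_proj H)" by (rule digraph_iso_swap[OF H.wf_digraph])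
    with ind show ?thesis by blast
  qed
  ultimately show ?thesis unfolding induced_free_def by blast
qed

definition path_graph :: "nat \<Rightarrow> nat pair_pre_digraph" where
  "path_graph t = \<lparr> pverts = {..<t},
     parcs = {(i, j). i < t \<and> j < t \<and> (j = Suc i \<or> i = Suc j)} \<rparr>"

text \<open>The cycle on \<open>t\<close> vertices; intended for \<open>t \<ge> 3\<close>.\<close>

definition cycle_graph :: "nat \<Rightarrow> nat pair_pre_digraph" where
  "cycle_graph t = \<lparr> pverts = {..<t},
     parcs = {(i, j). i < t \<and> j < t \<and> (j = Suc i mod t \<or> i = Suc j mod t)} \<rparr>"

text \<open>The four-cycle on \<open>0, 1, 2, 3\<close> with a pendant vertex \<open>4\<close> attached to \<open>0\<close>.\<close>

definition banner :: "nat pair_pre_digraph" where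
  "banner = \<lparr> pverts = insert 4 (pverts (cycle_graph 4)),
     parcs = parcs (cycle_graph 4) \<union> {(0, 4), (4, 0)} \<rparr>"

definition is_coloring :: "nat \<Rightarrow> 'a pair_pre_digraph \<Rightarrow> ('a \<Rightarrow> nat) \<Rightarrow> bool" where
  "is_coloring k G \<phi> \<longleftrightarrow>
     (\<forall>v \<in> pverts G. \<phi> v \<in> {1..k}) \<and> (\<forall>(u, v) \<in> parcs G. \<phi> u \<noteq> \<phi> v)"

definition colorable :: "nat \<Rightarrow> 'a pair_pre_digraph \<Rightarrow> bool" where
  "colorable k G \<longleftrightarrow> (\<exists>\<phi>. is_coloring k G \<phi>)"

lemma pair_graph_path_graph: "pair_graph (path_graph t)"
proof -
  have "finite (parcs (path_graph t))"
    by (rule finite_subset[of _ "{..<t} \<times> {..<t}"]) (auto simp: path_graph_def)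
  then show ?thesis
    by unfold_locales (auto simp: path_graph_def symmetric_def intro!: symI)
qed

lemma parcs_banner:
  "parcs banner =
     {(0, 1), (1, 0), (1, 2), (2, 1), (2, 3), (3, 2), (3, 0), (0, 3), (0, 4), (4, 0)}"
proof -
  have lt: "i < 4 \<longleftrightarrow> i = 0 \<or> i = 1 \<or> i = 2 \<or> i = 3" for i :: nat
    by arith
  have "{(i, j). i < 4 \<and> j < 4 \<and> (j = Suc i mod 4 \<or> i = Suc j mod 4)} =
    {(0::nat, 1::nat), (1, 0), (1, 2), (2, 1), (2, 3), (3, 2), (3, 0), (0, 3)}"
    unfolding lt by force
  then show ?thesis by (auto simp: banner_def cycle_graph_def)
qed

lemma pverts_banner: "pverts banner = {0, 1, 2, 3, 4}"
  by (auto simp: banner_def cycle_graph_def)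

lemma pair_graph_banner: "pair_graph banner"
  by unfold_locales (auto simp: parcs_banner pverts_banner symmetric_def intro!: symI)


section \<open>Random access machines with unit cost\<close>

text \<open>
  A program uses the registers it names and an unbounded memory addressed through
  registers; every cell holds a natural number. Each assignment and each evaluation of a test
  costs one time unit. The only arithmetic operations are addition and truncated subtraction, so
  the binary length of a value grows by at most one per step. Hence time on this machine and
  on Turing machines agree up to a polynomial. With unit-cost multiplication this would fail.
\<close>

datatype program =
    Const nat nat         \<comment> \<open>\<open>r\<^sub>x := c\<close>\<close>
  | Move nat nat          \<comment> \<open>\<open>r\<^sub>x := r\<^sub>y\<close>\<close>
  | Add nat nat nat       \<comment> \<open>\<open>r\<^sub>x := r\<^sub>y + r\<^sub>z\<close>\<close>
  | Sub nat nat nat       \<comment> \<open>\<open>r\<^sub>x := max 0 (r\<^sub>y - r\<^sub>z)\<close>\<close>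
  | Load nat nat          \<comment> \<open>\<open>r\<^sub>x := mem[r\<^sub>y]\<close>\<close>
  | Store nat nat         \<comment> \<open>\<open>mem[r\<^sub>x] := r\<^sub>y\<close>\<close>
  | Seq program program
  | IfNZ nat program program
  | WhileNZ nat program

type_synonym machine_state = "(nat \<Rightarrow> nat) \<times> (nat \<Rightarrow> nat)" \<comment> \<open>registers and memory\<close>

text \<open>\<open>exec p s t s'\<close>: started in state \<open>s\<close>, program \<open>p\<close> halts after exactly \<open>t\<close> steps in \<open>s'\<close>.\<close>

inductive exec :: "program \<Rightarrow> machine_state \<Rightarrow> nat \<Rightarrow> machine_state \<Rightarrow> bool" where
  Const: "exec (Const x c) (r, m) 1 (r(x := c), m)"
| Move: "exec (Move x y) (r, m) 1 (r(x := r y), m)"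
| Add: "exec (Add x y z) (r, m) 1 (r(x := r y + r z), m)"
| Sub: "exec (Sub x y z) (r, m) 1 (r(x := r y - r z), m)"
| Load: "exec (Load x y) (r, m) 1 (r(x := m (r y)), m)"
| Store: "exec (Store x y) (r, m) 1 (r, m(r x := r y))"
| Seq: "exec p s t s' \<Longrightarrow> exec q s' t' s'' \<Longrightarrow> exec (Seq p q) s (t + t') s''"
| IfTrue: "fst s x \<noteq> 0 \<Longrightarrow> exec p s t s' \<Longrightarrow> exec (IfNZ x p q) s (Suc t) s'"
| IfFalse: "fst s x = 0 \<Longrightarrow> exec q s t s' \<Longrightarrow> exec (IfNZ x p q) s (Suc t) s'"
| WhileTrue: "fst s x \<noteq> 0 \<Longrightarrow> exec p s t s' \<Longrightarrow> exec (WhileNZ x p) s' t' s'' \<Longrightarrow>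
    exec (WhileNZ x p) s (Suc (t + t')) s''"
| WhileFalse: "fst s x = 0 \<Longrightarrow> exec (WhileNZ x p) s 1 s"

inductive_cases exec_elims:
  "exec (Const x c) s t s'"
  "exec (Move x y) s t s'"
  "exec (Add x y z) s t s'"
  "exec (Sub x y z) s t s'"
  "exec (Load x y) s t s'"
  "exec (Store x y) s t s'"
  "exec (Seq p q) s t s'"
  "exec (IfNZ x p q) s t s'"
  "exec (WhileNZ x p) s t s'"

lemma exec_deterministic:
  "exec p s t s' \<Longrightarrow> exec p s u s'' \<Longrightarrow> u = t \<and> s'' = s'"
proof (induction arbitrary: u s'' rule: exec.induct)
  case (Seq p s t s' q t' s1)
  from Seq.prems obtain v s2 v' where "u = v + v'" "exec p s v s2" "exec q s2 v' s''"
    by (rule exec_elims)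
  with Seq.IH show ?case by blast
next
  case (IfTrue s x p t s' q)
  from IfTrue.prems IfTrue.hyps(1) obtain v where "u = Suc v" "exec p s v s''"
    by (cases rule: exec_elims(8)) auto
  with IfTrue.IH show ?case by blast
next
  case (IfFalse s x q t s' p)
  from IfFalse.prems IfFalse.hyps(1) obtain v where "u = Suc v" "exec q s v s''"
    by (cases rule: exec_elims(8)) auto
  with IfFalse.IH show ?case by blast
next
  case (WhileTrue s x p t s' t' s1)
  from WhileTrue.prems WhileTrue.hyps(1) obtain v s2 v'
    where "u = Suc (v + v')" "exec p s v s2" "exec (WhileNZ x p) s2 v' s''"
    by (cases rule: exec_elims(9)) auto
  with WhileTrue.IH show ?case by blast
next
  case (WhileFalse s x p)
  from WhileFalse.prems WhileFalse.hyps show ?case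
    by (cases rule: exec_elims(9)) auto
qed (erule exec_elims; simp)+

text \<open>
  A binary word is presented in memory cells \<open>0, 1, \<dots>\<close>, its length in register \<open>0\<close>; everything
  else is initially \<open>0\<close>. On halting, register \<open>0\<close> holds the answer (nonzero means yes).
\<close>

definition initial_state :: "bool list \<Rightarrow> machine_state" where
  "initial_state w =
     ((\<lambda>_. 0)(0 := length w), (\<lambda>i. if i < length w then of_bool (w ! i) else 0))"

definition accepting :: "machine_state \<Rightarrow> bool" where
  "accepting s \<longleftrightarrow> fst s 0 \<noteq> 0"


section \<open>Polynomial-time solvability on a graph class\<close>

text \<open>The adjacency matrix, row by row, for the vertex ordering \<open>vs\<close>.\<close>

definition adjacency_word :: "'a pair_pre_digraph \<Rightarrow> 'a list \<Rightarrow> bool list" where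
  "adjacency_word G vs = concat (map (\<lambda>u. map (\<lambda>v. (u, v) \<in> parcs G) vs) vs)"

text \<open>
  \<open>C\<close> is a promise: nothing is required of the program on graphs outside \<open>C\<close>. The program and
  the polynomial are independent of the graph and of the order in which its vertices are listed.
  Vertices are natural numbers, which covers every finite graph up to isomorphism.
\<close>

definition poly_time_decidable_on ::
  "(nat pair_pre_digraph \<Rightarrow> bool) \<Rightarrow> (nat pair_pre_digraph \<Rightarrow> bool) \<Rightarrow> bool" where
  "poly_time_decidable_on C Q \<longleftrightarrow>
     (\<exists>(prog :: program) (p :: nat poly).
        \<forall>G vs. pair_graph G \<and> C G \<and> distinct vs \<and> set vs = pverts G \<longrightarrow>
          (\<exists>t s. exec prog (initial_state (adjacency_word G vs)) t s \<and>
             t \<le> poly p (length (adjacency_word G vs)) \<and>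
             (accepting s \<longleftrightarrow> Q G)))"

end

theory Submission
  imports Defs "HOL-Library.Ramsey"
begin

text \<open>
  Consider the game in which a spoiler names \<open>q\<close> vertices one after the other and a duplicator colors
  each of them at once, losing if two adjacent vertices get the same color. For some \<open>q\<close> the
  duplicator survives on a \<open>(P\<^sub>6, banner)\<close>-free graph if and only if the graph is 4-colorable. Since
  \<open>q\<close> is a constant, nested loops evaluate the game in polynomial time.

  The spoiler wins on non-4-colorable graphs by induction on the clique number. If two nonadjacent
  vertices have three pairwise nonadjacent common neighbours, then banner-freeness makes the
  anticomponent of these neighbours (within the common neighbourhood) a module, which has smaller
  clique number. One vertex from each maximal such module yields a graph without \<open>K\<^sub>2\<^sub>,\<^sub>3\<close>,
  and such a graph, being \<open>P\<^sub>6\<close>-free and of bounded clique number, has no long path, induced or not.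
  The spoiler walks along a path of modules, in each of them forcing the duplicator to exhibit a
  set of colors that suffices to color the module, and moves on to a component of the rest; the
  answers fit together to a coloring.
\<close>


section \<open>Long paths in graphs without large bicliques\<close>

text \<open>A vertex outside a module sees all of it or none of it, so the rest of the graph only
  notices which set of colors occurs inside. As soon as completely joined modules have disjoint
  color sets, each can be recolored at will within its own set. Hence a constant number of answers
  inside a module can stand for a coloring of the whole module. Bounded path length matters because
  a winning duplicator has an answer to every continuation: the components left after a module are
  alternative continuations of one and the same position. The number of rounds therefore grows with
  the depth of a depth-first search and not with the number of modules. A bound on the clique
  number, from which the induction descends, is enforced by the game itself: \<open>k + 1\<close>
  picks inside a clique on \<open>k + 1\<close> vertices defeat \<open>k\<close> colors. The path
  bound comes from a compactness argument and is not explicit, so neither is the number of rounds.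
  The program only needs that this number is a constant.\<close>

definition simple_graph :: "('a \<Rightarrow> 'a \<Rightarrow> bool) \<Rightarrow> bool" where
  "simple_graph E \<longleftrightarrow> (\<forall>x y. E x y \<longrightarrow> E y x) \<and> (\<forall>x. \<not> E x x)"

lemma simple_graph_sym: "simple_graph E \<Longrightarrow> E x y \<Longrightarrow> E y x"
  unfolding simple_graph_def by blast

lemma simple_graph_irrefl: "simple_graph E \<Longrightarrow> \<not> E x x"
  unfolding simple_graph_def by blast

text \<open>No two vertices of \<open>P\<^sub>6\<close> have the same neighbours, so the six vertices are distinct.\<close>

definition induced_P6 :: "('a \<Rightarrow> 'a \<Rightarrow> bool) \<Rightarrow> 'a \<Rightarrow> 'a \<Rightarrow> 'a \<Rightarrow> 'a \<Rightarrow> 'a \<Rightarrow> 'a \<Rightarrow> bool" where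
  "induced_P6 E a b c d e f \<longleftrightarrow>
     E a b \<and> E b c \<and> E c d \<and> E d e \<and> E e f \<and>
     \<not> E a c \<and> \<not> E a d \<and> \<not> E a e \<and> \<not> E a f \<and> \<not> E b d \<and> \<not> E b e \<and> \<not> E b f \<and>
     \<not> E c e \<and> \<not> E c f \<and> \<not> E d f"

definition P6_free :: "('a \<Rightarrow> 'a \<Rightarrow> bool) \<Rightarrow> 'a set \<Rightarrow> bool" where
  "P6_free E W \<longleftrightarrow>
     (\<forall>a\<in>W. \<forall>b\<in>W. \<forall>c\<in>W. \<forall>d\<in>W. \<forall>e\<in>W. \<forall>f\<in>W. \<not> induced_P6 E a b c d e f)"

definition induced_K23 :: "('a \<Rightarrow> 'a \<Rightarrow> bool) \<Rightarrow> 'a \<Rightarrow> 'a \<Rightarrow> 'a \<Rightarrow> 'a \<Rightarrow> 'a \<Rightarrow> bool" where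
  "induced_K23 E a a' b b' b'' \<longleftrightarrow>
     a \<noteq> a' \<and> b \<noteq> b' \<and> b \<noteq> b'' \<and> b' \<noteq> b'' \<and>
     E a b \<and> E a b' \<and> E a b'' \<and> E a' b \<and> E a' b' \<and> E a' b'' \<and>
     \<not> E a a' \<and> \<not> E b b' \<and> \<not> E b b'' \<and> \<not> E b' b''"

definition K23_free :: "('a \<Rightarrow> 'a \<Rightarrow> bool) \<Rightarrow> 'a set \<Rightarrow> bool" where
  "K23_free E W \<longleftrightarrow> (\<forall>a\<in>W. \<forall>a'\<in>W. \<forall>b\<in>W. \<forall>b'\<in>W. \<forall>b''\<in>W. \<not> induced_K23 E a a' b b' b'')"

definition clique_free :: "('a \<Rightarrow> 'a \<Rightarrow> bool) \<Rightarrow> nat \<Rightarrow> 'a set \<Rightarrow> bool" where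
  "clique_free E w W \<longleftrightarrow>
     (\<forall>S\<subseteq>W. finite S \<and> card S = w \<longrightarrow> (\<exists>u\<in>S. \<exists>v\<in>S. u \<noteq> v \<and> \<not> E u v))"

lemma P6_freeD:
  "P6_free E W \<Longrightarrow> a \<in> W \<Longrightarrow> b \<in> W \<Longrightarrow> c \<in> W \<Longrightarrow> d \<in> W \<Longrightarrow> e \<in> W \<Longrightarrow> f \<in> W \<Longrightarrow>
    \<not> induced_P6 E a b c d e f"
  unfolding P6_free_def by blast

lemma K23_freeD:
  "K23_free E W \<Longrightarrow> a \<in> W \<Longrightarrow> a' \<in> W \<Longrightarrow> b \<in> W \<Longrightarrow> b' \<in> W \<Longrightarrow> b'' \<in> W \<Longrightarrow>
    \<not> induced_K23 E a a' b b' b''"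
  unfolding K23_free_def by blast

section \<open>Ultrafilters and infinite independent sets\<close>

lemma ultrafilter_exists:
  fixes F\<^sub>0 :: "'a filter"
  assumes "F\<^sub>0 \<noteq> bot"
  obtains F where "F \<noteq> bot" "F \<le> F\<^sub>0" "\<And>P. eventually P F \<or> eventually (\<lambda>x. \<not> P x) F"
proof -
  \<comment> \<open>Zorn's lemma for the reversed order: the infimum of a chain of proper filters is
    proper, because a chain is a filter base. A minimal proper filter decides every
    \<open>P\<close>, since otherwise restricting it to \<open>P\<close> would give a strictly finer
    proper filter.\<close>
  let ?A = "{F. F \<noteq> bot \<and> F \<le> F\<^sub>0}"
  have "\<exists>m\<in>?A. \<forall>a\<in>?A. m \<ge> a \<longrightarrow> a = m"
  proof (rule predicate_Zorn)
    show "partial_order_on ?A (relation_of (\<ge>) ?A)"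
      by (rule partial_order_on_relation_ofI) auto
  next
    fix C assume C: "C \<in> Chains (relation_of (\<ge>) ?A)"
    then have sub: "C \<subseteq> ?A" and chain: "\<And>F G. F \<in> C \<Longrightarrow> G \<in> C \<Longrightarrow> F \<le> G \<or> G \<le> F"
      by (auto simp: Chains_def relation_of_def)
    show "\<exists>u\<in>?A. \<forall>a\<in>C. a \<ge> u"
    proof (cases "C = {}")
      case True
      then show ?thesis using assms by auto
    next
      case False
      have "eventually P (Inf C) \<longleftrightarrow> (\<exists>b\<in>C. eventually P b)" for P
        using False
      proof (rule eventually_Inf_base)
        fix F G assume "F \<in> C" "G \<in> C"
        then show "\<exists>x\<in>C. x \<le> inf F G" using chain[of F G] by (metis inf.orderE inf.commute order_refl)
      qed
      with sub have "Inf C \<noteq> bot" by (auto simp: trivial_limit_def)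
      moreover obtain G where "G \<in> C" using False by blast
      then have "Inf C \<le> F\<^sub>0" using sub by (intro Inf_lower2[of G]) auto
      ultimately show ?thesis by (auto intro: Inf_lower)
    qed
  qed
  then obtain F where F: "F \<in> ?A" and F_max: "\<forall>G\<in>?A. F \<ge> G \<longrightarrow> G = F" ..
  have max: "G = F" if "G \<noteq> bot" "G \<le> F" for G
    using F_max F that order_trans by blast
  have "eventually P F \<or> eventually (\<lambda>x. \<not> P x) F" for P
  proof (rule ccontr)
    assume n: "\<not> ?thesis"
    let ?G = "inf F (principal {x. P x})"
    have "?G \<noteq> bot" using n by (auto simp: trivial_limit_def eventually_inf_principal)
    then have "?G = F" using max by simp
    moreover have "eventually P ?G" by (simp add: eventually_inf_principal)
    ultimately show False using n by simp
  qed
  with F show ?thesis by (intro that[of F]) auto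
qed

text \<open>Infinite Ramsey theorem for pairs, colored by adjacency; the hypothesis on
  \<open>Z\<close> excludes a homogeneous set of adjacent pairs.\<close>

lemma infinite_independent_subset:
  assumes "\<And>x y. A x y \<Longrightarrow> A y x" "\<And>x. \<not> A x x"
    and no_clique: "\<And>S. S \<subseteq> Z \<Longrightarrow> infinite S \<Longrightarrow> \<exists>u\<in>S. \<exists>v\<in>S. u \<noteq> v \<and> \<not> A u v"
    and "infinite Z"
  obtains T where "T \<subseteq> Z" "infinite T" "\<And>u v. u \<in> T \<Longrightarrow> v \<in> T \<Longrightarrow> \<not> A u v"
proof -
  define f where "f X = (if \<exists>u\<in>X. \<exists>v\<in>X. A u v then 1 else 0 :: nat)" for X
  have *: "f {x, y} = (if A x y then 1 else 0)" for x y
    unfolding f_def using assms(1,2) by auto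
  have "\<forall>x\<in>Z. \<forall>y\<in>Z. x \<noteq> y \<longrightarrow> f {x, y} < 2" by (simp add: f_def)
  from Ramsey2[OF \<open>infinite Z\<close> this]
  obtain Y t where Y: "Y \<subseteq> Z" "infinite Y" and t: "\<forall>x\<in>Y. \<forall>y\<in>Y. x \<noteq> y \<longrightarrow> f {x, y} = t"
    by blast
  obtain u v where "u \<in> Y" "v \<in> Y" "u \<noteq> v" "\<not> A u v" using no_clique[OF Y] by blast
  with t * have "t = 0" by metis
  with t * have "\<not> A x y" if "x \<in> Y" "y \<in> Y" for x y using that assms(2) by (metis zero_neq_one)
  with Y that show ?thesis by blast
qed

text \<open>
  An ultraproduct of counterexamples with longer and longer paths would be such a ray; the locale
  is contradictory. A property is called generic if it holds for \<open>F\<close>-almost all vertices.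
\<close>

locale generic_ray =
  fixes A :: "nat \<Rightarrow> nat \<Rightarrow> bool" and F :: "nat filter" and w :: nat
  assumes sym: "A x y \<Longrightarrow> A y x" and irrefl: "\<not> A x x"
    and succ: "A n (Suc n)"
    and no_P6: "\<not> induced_P6 A a b c d e f"
    and no_K23: "\<not> induced_K23 A a a' b b' b''"
    and no_K: "clique_free A w UNIV"
    and proper: "F \<noteq> bot" and nonprincipal: "eventually (\<lambda>x. x \<noteq> c) F"
    and ultra: "eventually P F \<or> eventually (\<lambda>x. \<not> P x) F"
begin

section \<open>Limit neighbours of nonstandard vertices\<close>

lemma not_clique:
  assumes "infinite S"
  shows "\<exists>u\<in>S. \<exists>v\<in>S. u \<noteq> v \<and> \<not> A u v"
proof -
  obtain T where "T \<subseteq> S" "finite T" "card T = w"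
    using infinite_arbitrarily_large[OF assms] by blast
  then show ?thesis using no_K unfolding clique_free_def by blast
qed

text \<open>In the ultrapower along \<open>F\<close>, a spread \<open>g\<close> represents a
  nonstandard vertex.\<close>

definition spread :: "(nat \<Rightarrow> nat) \<Rightarrow> bool" where
  "spread g \<longleftrightarrow> (\<forall>c. eventually (\<lambda>x. g x \<noteq> c) F)"

lemma spread_id: "spread (\<lambda>x. x)"
  unfolding spread_def using nonprincipal by blast

lemma spread_notin:
  assumes "spread g" "finite S"
  shows "eventually (\<lambda>x. g x \<notin> S) F"
proof -
  have "eventually (\<lambda>x. \<forall>c\<in>S. g x \<noteq> c) F"
    using assms by (intro eventually_ball_finite) (auto simp: spread_def)
  then show ?thesis by (rule eventually_mono) auto
qed

lemma generic_witness:
  assumes "eventually P F"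
  shows "\<exists>x. P x"
  using assms proper by (rule eventually_happens'[rotated])

text \<open>The standard vertices adjacent to the vertex of the ultrapower that \<open>g\<close>
  represents.\<close>

definition limit_nbrs :: "(nat \<Rightarrow> nat) \<Rightarrow> nat set" where
  "limit_nbrs g = {c. eventually (\<lambda>x. A c (g x)) F}"

text \<open>Two nonadjacent limit neighbours have the generic values of \<open>g\<close> as common
  neighbours. These are infinitely many because \<open>g\<close> is spread, so three of them are
  pairwise nonadjacent and complete an induced \<open>K23\<close>.\<close>

lemma limit_nbrs_clique:
  assumes g: "spread g" and c: "c \<in> limit_nbrs g" "c' \<in> limit_nbrs g" "c \<noteq> c'"
  shows "A c c'"
proof (rule ccontr)
  assume n: "\<not> A c c'"
  let ?C = "{y. A c y \<and> A c' y}"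
  have ev: "eventually (\<lambda>x. g x \<in> ?C) F"
    using c(1,2) unfolding limit_nbrs_def mem_Collect_eq by (rule eventually_elim2) simp
  have inf: "infinite ?C"
  proof
    assume "finite ?C"
    from spread_notin[OF g this] ev have "eventually (\<lambda>x. False) F" by eventually_elim blast
    with proper show False by simp
  qed
  obtain T where T: "T \<subseteq> ?C" "infinite T" "\<And>u v. u \<in> T \<Longrightarrow> v \<in> T \<Longrightarrow> \<not> A u v"
    using infinite_independent_subset[of A, OF sym irrefl not_clique inf] by blast
  obtain S where S: "S \<subseteq> T" "finite S" "card S = 3"
    using infinite_arbitrarily_large[OF T(2)] by blast
  then obtain x y z where "S = {x, y, z}" "x \<noteq> y" "y \<noteq> z" "x \<noteq> z"
    by (auto simp: card_3_iff)
  with S T n c(3) have "induced_K23 A c c' x y z" unfolding induced_K23_def by auto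
  with no_K23 show False by blast
qed

lemma finite_limit_nbrs:
  assumes "spread g"
  shows "finite (limit_nbrs g)"
  using not_clique limit_nbrs_clique[OF assms] by blast

lemma notin_limit_nbrs: "c \<notin> limit_nbrs g \<Longrightarrow> eventually (\<lambda>x. \<not> A c (g x)) F"
  using ultra unfolding limit_nbrs_def by blast

section \<open>Distance to a generic vertex\<close>

primrec walk :: "nat \<Rightarrow> nat \<Rightarrow> nat \<Rightarrow> nat \<Rightarrow> bool" where
  "walk n 0 v x \<longleftrightarrow> v = x \<and> n \<le> v"
| "walk n (Suc d) v x \<longleftrightarrow> n \<le> v \<and> (\<exists>y. A v y \<and> walk n d y x)"

lemma walk_ge: "walk n d v x \<Longrightarrow> n \<le> v"
  by (cases d) auto

lemma walk_line: "n \<le> v \<Longrightarrow> walk n d v (v + d)"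
proof (induction d arbitrary: v)
  case (Suc d)
  then have "walk n d (Suc v) (v + Suc d)" using Suc.IH[of "Suc v"] by simp
  then show ?case using Suc.prems succ by auto
qed simp

lemma walk_exists: "n \<le> x \<Longrightarrow> \<exists>d. walk n d n x"
  using walk_line[of n n "x - n"] by auto

lemma walk_SucI: "A v y \<Longrightarrow> walk n d y x \<Longrightarrow> n \<le> v \<Longrightarrow> walk n (Suc d) v x"
  by auto

definition far :: "nat \<Rightarrow> nat \<Rightarrow> nat \<Rightarrow> nat \<Rightarrow> bool" where
  "far n d v x \<longleftrightarrow> walk n d v x \<and> (\<forall>d'<d. \<not> walk n d' v x)"

lemma far_step:
  assumes "far n (Suc d) v x"
  obtains y where "A v y" "far n d y x"
proof -
  from assms obtain y where y: "A v y" "walk n d y x" and v: "n \<le> v"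
    by (auto simp: far_def)
  have "far n d y x"
    using assms y v unfolding far_def by (metis Suc_less_eq walk_SucI)
  with y that show ?thesis by blast
qed

lemma far_not_adjacent:
  assumes "far n d v x" "far n e y x" "Suc e < d"
  shows "\<not> A v y"
  using assms walk_ge walk_SucI unfolding far_def by metis

text \<open>A shortest walk is an induced path, and its first five edges already form a
  \<open>P6\<close>.\<close>

lemma far_bounded:
  assumes "far n d v x"
  shows "d < 5"
proof (rule ccontr)
  assume "\<not> d < 5"
  then have d: "d = Suc (Suc (Suc (Suc (Suc (d - 5)))))" by simp
  obtain e where e: "d = Suc (Suc (Suc (Suc (Suc e))))" using d by blast
  obtain v1 where 1: "A v v1" "far n (Suc (Suc (Suc (Suc e)))) v1 x"
    using assms unfolding e by (rule far_step)
  obtain v2 where 2: "A v1 v2" "far n (Suc (Suc (Suc e))) v2 x" using 1(2) by (rule far_step)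
  obtain v3 where 3: "A v2 v3" "far n (Suc (Suc e)) v3 x" using 2(2) by (rule far_step)
  obtain v4 where 4: "A v3 v4" "far n (Suc e) v4 x" using 3(2) by (rule far_step)
  obtain v5 where 5: "A v4 v5" "far n e v5 x" using 4(2) by (rule far_step)
  note n = far_not_adjacent[OF assms[unfolded e]] far_not_adjacent[OF 1(2)]
    far_not_adjacent[OF 2(2)] far_not_adjacent[OF 3(2)]
  have "induced_P6 A v v1 v2 v3 v4 v5"
    unfolding induced_P6_def
    using 1(1) 2(1) 3(1) 4(1) 5(1) n(1)[OF 2(2)] n(1)[OF 3(2)] n(1)[OF 4(2)] n(1)[OF 5(2)]
      n(2)[OF 3(2)] n(2)[OF 4(2)] n(2)[OF 5(2)] n(3)[OF 4(2)] n(3)[OF 5(2)] n(4)[OF 5(2)]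
    by simp
  with no_P6 show False by blast
qed

text \<open>The ray joins \<open>n\<close> to every later vertex and a shortest walk has fewer than
  5 edges. Of finitely many cases that cover almost all \<open>x\<close>, an ultrafilter selects
  one.\<close>

lemma generic_walk_exists: "\<exists>d. eventually (walk n d n) F"
proof (rule ccontr)
  assume "\<not> ?thesis"
  then have "eventually (\<lambda>x. \<forall>d\<in>{..<5}. \<not> walk n d n x) F"
    by (intro eventually_ball_finite) (use ultra in auto)
  moreover have "eventually (\<lambda>x. x \<notin> {..<n}) F"
    using spread_notin[OF spread_id, of "{..<n}"] by simp
  ultimately have "eventually (\<lambda>x. (\<forall>d\<in>{..<5}. \<not> walk n d n x) \<and> x \<notin> {..<n}) F"
    by (rule eventually_conj)
  then obtain x where x: "\<forall>d\<in>{..<5}. \<not> walk n d n x" "n \<le> x"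
    using generic_witness by fastforce
  define d where "d = (LEAST d. walk n d n x)"
  have "walk n d n x" unfolding d_def using walk_exists[OF x(2)] by (rule LeastI_ex)
  then have "far n d n x" unfolding far_def d_def using not_less_Least by blast
  then have "d < 5" by (rule far_bounded)
  with \<open>walk n d n x\<close> x(1) show False by blast
qed

text \<open>Minimizing over the starting vertex as well forces every later vertex of a shortest walk
  to vary with \<open>x\<close>, see \<open>far_spread\<close>. Walks stay among the vertices from
  \<open>n\<close> on, so raising \<open>n\<close> produces ever larger starting vertices.\<close>

definition generic_distance :: "nat \<Rightarrow> nat" where
  "generic_distance n = (LEAST d. \<exists>v. eventually (walk n d v) F)"

lemma generic_distance_minimal:
  "d < generic_distance n \<Longrightarrow> eventually (\<lambda>x. \<not> walk n d v x) F"
  using not_less_Least[of d "\<lambda>d. \<exists>v. eventually (walk n d v) F"] ultra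
  unfolding generic_distance_def by blast

lemma obtain_center:
  obtains v where "n \<le> v" "eventually (far n (generic_distance n) v) F"
proof -
  have "\<exists>v. eventually (walk n (generic_distance n) v) F"
    unfolding generic_distance_def
    by (rule LeastI_ex) (use generic_walk_exists in blast)
  then obtain v where v: "eventually (walk n (generic_distance n) v) F" by blast
  have "eventually (\<lambda>x. \<forall>d\<in>{..<generic_distance n}. \<not> walk n d v x) F"
    by (intro eventually_ball_finite) (auto intro: generic_distance_minimal)
  with v have "eventually (far n (generic_distance n) v) F"
    by eventually_elim (auto simp: far_def)
  moreover have "n \<le> v" using generic_witness[OF v] walk_ge by blast
  ultimately show ?thesis using that by blast
qed

lemma far_spread:
  assumes "eventually (\<lambda>x. far n d (g x) x) F" "d < generic_distance n"
  shows "spread g"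
  unfolding spread_def
proof
  fix c
  show "eventually (\<lambda>x. g x \<noteq> c) F"
    using assms(1) generic_distance_minimal[OF assms(2), of c]
    by eventually_elim (auto simp: far_def)
qed

text \<open>At distance 3 or more, the vertices \<open>u1 x\<close>, \<open>u2 x\<close>,
  \<open>u3 x\<close> that follow the center \<open>v\<close> vary with \<open>x\<close>. Two such
  walks for unrelated \<open>x\<close> and \<open>x'\<close>, glued at \<open>v\<close>, contain the
  induced path \<open>u3 x\<close>, \<open>u2 x\<close>, \<open>u1 x\<close>, \<open>v\<close>,
  \<open>u1 x'\<close>, \<open>u2 x'\<close>.\<close>

lemma generic_distance_le_2: "generic_distance n \<le> 2"
proof (rule ccontr)
  assume "\<not> ?thesis"
  then have "generic_distance n = Suc (Suc (Suc (generic_distance n - 3)))" by simp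
  then obtain e where e: "generic_distance n = Suc (Suc (Suc e))" by blast
  obtain v where v: "eventually (far n (Suc (Suc (Suc e))) v) F"
    using obtain_center[of n] unfolding e by blast
  have "\<forall>x. \<exists>y\<^sub>1 y\<^sub>2 y\<^sub>3. far n (Suc (Suc (Suc e))) v x \<longrightarrow>
      A v y\<^sub>1 \<and> A y\<^sub>1 y\<^sub>2 \<and> A y\<^sub>2 y\<^sub>3 \<and> far n (Suc (Suc e)) y\<^sub>1 x \<and> far n (Suc e) y\<^sub>2 x \<and> far n e y\<^sub>3 x"
    by (metis far_step)
  then obtain u1 u2 u3 where u: "\<And>x. far n (Suc (Suc (Suc e))) v x \<Longrightarrow>
      A v (u1 x) \<and> A (u1 x) (u2 x) \<and> A (u2 x) (u3 x) \<and>
      far n (Suc (Suc e)) (u1 x) x \<and> far n (Suc e) (u2 x) x \<and> far n e (u3 x) x"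
    by metis
  have adj: "eventually (\<lambda>x. A v (u1 x) \<and> A (u1 x) (u2 x) \<and> A (u2 x) (u3 x) \<and>
      \<not> A v (u2 x) \<and> \<not> A v (u3 x) \<and> \<not> A (u1 x) (u3 x)) F"
    using v
  proof eventually_elim
    case (elim x)
    note U = u[OF elim]
    show ?case
      using U far_not_adjacent[OF elim, of "Suc e" "u2 x"] far_not_adjacent[OF elim, of e "u3 x"]
        far_not_adjacent[of n "Suc (Suc e)" "u1 x" x e "u3 x"]
      by simp
  qed
  have "eventually (\<lambda>x. far n (Suc (Suc e)) (u1 x) x) F"
    "eventually (\<lambda>x. far n (Suc e) (u2 x) x) F" "eventually (\<lambda>x. far n e (u3 x) x) F"
    using v by (eventually_elim, simp add: u)+
  from this[THEN far_spread] have s1: "spread u1" and s2: "spread u2" and s3: "spread u3"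
    by (simp_all add: e)
  note fin = finite_limit_nbrs[OF s1] finite_limit_nbrs[OF s2]
  \<comment> \<open>The first walk is fixed at an \<open>x\<close> where its three vertices avoid
    the finite sets of limit neighbours of \<open>u1\<close> and \<open>u2\<close>. They are then
    nonadjacent to \<open>u1 x'\<close> and \<open>u2 x'\<close> for almost all
    \<open>x'\<close>.\<close>
  have "eventually (\<lambda>x. A v (u1 x) \<and> A (u1 x) (u2 x) \<and> A (u2 x) (u3 x) \<and>
      \<not> A v (u2 x) \<and> \<not> A v (u3 x) \<and> \<not> A (u1 x) (u3 x) \<and>
      u1 x \<notin> limit_nbrs u1 \<and> u2 x \<notin> limit_nbrs u1 \<and> u3 x \<notin> limit_nbrs u1 \<and>
      u1 x \<notin> limit_nbrs u2 \<and> u2 x \<notin> limit_nbrs u2 \<and> u3 x \<notin> limit_nbrs u2) F"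
    using adj spread_notin[OF s1 fin(1)] spread_notin[OF s2 fin(1)] spread_notin[OF s3 fin(1)]
      spread_notin[OF s1 fin(2)] spread_notin[OF s2 fin(2)] spread_notin[OF s3 fin(2)]
    by eventually_elim blast
  then obtain x where x: "A v (u1 x)" "A (u1 x) (u2 x)" "A (u2 x) (u3 x)"
      "\<not> A v (u2 x)" "\<not> A v (u3 x)" "\<not> A (u1 x) (u3 x)"
    and nl: "u1 x \<notin> limit_nbrs u1" "u2 x \<notin> limit_nbrs u1" "u3 x \<notin> limit_nbrs u1"
      "u1 x \<notin> limit_nbrs u2" "u2 x \<notin> limit_nbrs u2" "u3 x \<notin> limit_nbrs u2"
    using generic_witness by blast
  have "eventually (\<lambda>x'. induced_P6 A (u3 x) (u2 x) (u1 x) v (u1 x') (u2 x')) F"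
    using adj nl[THEN notin_limit_nbrs]
    by eventually_elim (use x sym in \<open>auto simp: induced_P6_def\<close>)
  with no_P6 proper show False by simp
qed

text \<open>Generic distance 0 would make almost all \<open>x\<close> equal to the center, and
  distance 1 would make the center a limit neighbour, although these are all smaller than
  \<open>n\<close>. So the distance is 2, and \<open>y x\<close> is the middle vertex.\<close>

lemma spider:
  assumes n: "\<And>c. c \<in> limit_nbrs (\<lambda>x. x) \<Longrightarrow> c < n"
  obtains v y where "n \<le> v" "spread y"
    "eventually (\<lambda>x. A v (y x) \<and> A (y x) x \<and> \<not> A v x) F"
proof -
  obtain v where v: "n \<le> v" "eventually (far n (generic_distance n) v) F"
    by (rule obtain_center)
  have "generic_distance n \<noteq> 0"
  proof
    assume "generic_distance n = 0"
    with v(2) have "eventually (\<lambda>x. v = x) F" by (auto simp: far_def elim: eventually_mono)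
    with nonprincipal[of v] have "eventually (\<lambda>x. False) F" by eventually_elim auto
    with proper show False by simp
  qed
  moreover have "generic_distance n \<noteq> 1"
  proof
    assume "generic_distance n = 1"
    with v(2) have "eventually (\<lambda>x. A v x) F" by (auto simp: far_def elim: eventually_mono)
    with n[of v] v(1) show False by (auto simp: limit_nbrs_def)
  qed
  ultimately have d: "generic_distance n = Suc (Suc 0)"
    using generic_distance_le_2[of n] by linarith
  have "\<forall>x. \<exists>y. far n (Suc (Suc 0)) v x \<longrightarrow> A v y \<and> far n (Suc 0) y x"
    by (metis far_step)
  then obtain y where y: "\<And>x. far n (Suc (Suc 0)) v x \<Longrightarrow> A v (y x) \<and> far n (Suc 0) (y x) x"
    by metis
  have "eventually (\<lambda>x. far n (Suc 0) (y x) x) F"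
    using v(2) unfolding d by eventually_elim (simp add: y)
  then have "spread y" by (rule far_spread) (simp add: d)
  moreover have "eventually (\<lambda>x. A v (y x) \<and> A (y x) x \<and> \<not> A v x) F"
    using v(2) unfolding d
    by eventually_elim (use y in \<open>auto simp: far_def\<close>)
  ultimately show ?thesis using v(1) that by blast
qed

text \<open>Two nonadjacent centers \<open>u\<close>, \<open>v\<close> with generically nonadjacent
  middle vertices give the induced path \<open>u\<close>, \<open>Y u x\<close>, \<open>x\<close>,
  \<open>Y v x\<close>, \<open>v\<close>, \<open>Y v x'\<close>. Ramsey's theorem makes the centers
  independent, and the clique bound keeps the middle vertices of \<open>w\<close> centers from being
  pairwise adjacent.\<close>

theorem contradiction: False
proof -
  let ?center = "\<lambda>v y. spread y \<and> eventually (\<lambda>x. A v (y x) \<and> A (y x) x \<and> \<not> A v x) F"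
  let ?C = "{v. \<exists>y. ?center v y}"
  obtain m where m: "\<And>c. c \<in> limit_nbrs (\<lambda>x. x) \<Longrightarrow> c < m"
    using finite_limit_nbrs[OF spread_id] unfolding finite_nat_set_iff_bounded by blast
  have "infinite ?C"
    unfolding infinite_nat_iff_unbounded_le
  proof
    fix n
    show "\<exists>v\<ge>n. v \<in> ?C"
    proof (rule spider[of "max m n"])
      show "c < max m n" if "c \<in> limit_nbrs (\<lambda>x. x)" for c using m[OF that] by simp
    qed auto
  qed
  then obtain T where T: "T \<subseteq> ?C" "infinite T" "\<And>u v. u \<in> T \<Longrightarrow> v \<in> T \<Longrightarrow> \<not> A u v"
    using infinite_independent_subset[of A, OF sym irrefl not_clique] by blast
  from T(1) have "\<forall>v\<in>T. \<exists>y. ?center v y" by blast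
  from bchoice[OF this] obtain Y where Y: "\<And>v. v \<in> T \<Longrightarrow> ?center v (Y v)" by blast
  obtain S where S: "S \<subseteq> T" "finite S" "card S = w" using infinite_arbitrarily_large[OF T(2)] by blast
  have sp: "\<And>v. v \<in> T \<Longrightarrow> spread (Y v)" using Y by blast
  have inl: "\<And>v. v \<in> T \<Longrightarrow> v \<in> limit_nbrs (Y v)"
    unfolding limit_nbrs_def using Y by (blast intro: eventually_mono)
  \<comment> \<open>The limit neighbours of \<open>Y v\<close> form a clique that contains
    \<open>v\<close>, so no other member of the independent set \<open>T\<close> is among
    them.\<close>
  have notin: "u \<notin> limit_nbrs (Y v)" if "u \<in> T" "v \<in> T" "u \<noteq> v" for u v
    using limit_nbrs_clique[OF sp[OF that(2)]] inl[OF that(2)] T(3) that by blast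
  have sep: "eventually (\<lambda>x. \<not> A u (Y v x)) F" if "u \<in> T" "v \<in> T" "u \<noteq> v" for u v
    using notin[OF that] by (rule notin_limit_nbrs)
  have "\<exists>u\<in>S. \<exists>v\<in>S. u \<noteq> v \<and> eventually (\<lambda>x. \<not> A (Y u x) (Y v x)) F"
  proof (rule ccontr)
    assume "\<not> ?thesis"
    then have "eventually (\<lambda>x. A (Y u x) (Y v x)) F" if "u \<in> S" "v \<in> S" "u \<noteq> v" for u v
      using that ultra by blast
    then have "eventually (\<lambda>x. \<forall>u\<in>S. \<forall>v\<in>S. u \<noteq> v \<longrightarrow> A (Y u x) (Y v x)) F"
      using S(2) by (intro eventually_ball_finite ballI) (auto intro: always_eventually)
    then obtain x where x: "\<And>u v. u \<in> S \<Longrightarrow> v \<in> S \<Longrightarrow> u \<noteq> v \<Longrightarrow> A (Y u x) (Y v x)"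
      using generic_witness by blast
    have inj: "inj_on (\<lambda>u. Y u x) S"
    proof (rule inj_onI, rule ccontr)
      fix a b assume "a \<in> S" "b \<in> S" "Y a x = Y b x" "a \<noteq> b"
      with x[of a b] irrefl show False by simp
    qed
    have "card ((\<lambda>u. Y u x) ` S) = w" using card_image[OF inj] S(3) by simp
    moreover have "finite ((\<lambda>u. Y u x) ` S)" using S(2) by simp
    ultimately obtain u' v' where "u' \<in> (\<lambda>u. Y u x) ` S" "v' \<in> (\<lambda>u. Y u x) ` S" "u' \<noteq> v'" "\<not> A u' v'"
      using no_K unfolding clique_free_def by blast
    with x show False by auto
  qed
  then obtain u v where uv: "u \<in> T" "v \<in> T" "u \<noteq> v" and YY: "eventually (\<lambda>x. \<not> A (Y u x) (Y v x)) F"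
    using S(1) by blast
  note fin = finite_limit_nbrs[OF sp[OF uv(2)]]
  have "eventually (\<lambda>x. A u (Y u x) \<and> A (Y u x) x \<and> \<not> A u x \<and> A v (Y v x) \<and> A (Y v x) x \<and> \<not> A v x \<and>
      \<not> A (Y u x) (Y v x) \<and> \<not> A u (Y v x) \<and> \<not> A v (Y u x) \<and>
      Y u x \<notin> limit_nbrs (Y v) \<and> x \<notin> limit_nbrs (Y v) \<and> Y v x \<notin> limit_nbrs (Y v)) F"
    using Y[OF uv(1), THEN conjunct2] Y[OF uv(2), THEN conjunct2] YY sep[OF uv]
      sep[OF uv(2,1) uv(3)[symmetric]] spread_notin[OF sp[OF uv(1)] fin]
      spread_notin[OF sp[OF uv(2)] fin] spread_notin[OF spread_id fin]
    by eventually_elim blast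
  then obtain x where x: "A u (Y u x)" "A (Y u x) x" "\<not> A u x" "A v (Y v x)" "A (Y v x) x" "\<not> A v x"
      "\<not> A (Y u x) (Y v x)" "\<not> A u (Y v x)" "\<not> A v (Y u x)"
    and nl: "Y u x \<notin> limit_nbrs (Y v)" "x \<notin> limit_nbrs (Y v)" "Y v x \<notin> limit_nbrs (Y v)"
    using generic_witness by blast
  have "eventually (\<lambda>x'. induced_P6 A u (Y u x) x (Y v x) v (Y v x')) F"
    using Y[OF uv(2), THEN conjunct2] sep[OF uv] nl[THEN notin_limit_nbrs]
    by eventually_elim (use x sym T(3)[OF uv(1,2)] in \<open>auto simp: induced_P6_def\<close>)
  with no_P6 proper show False by simp
qed

end

section \<open>From the limit back to finite graphs\<close>

definition path_in :: "('a \<Rightarrow> 'a \<Rightarrow> bool) \<Rightarrow> 'a set \<Rightarrow> 'a list \<Rightarrow> bool" where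
  "path_in E W ps \<longleftrightarrow> distinct ps \<and> set ps \<subseteq> W \<and> successively E ps"

text \<open>A number names a position on all the paths \<open>p N\<close> at once, and
  \<open>A\<close> is adjacency of positions in the limit. A forbidden configuration in
  \<open>A\<close> concerns finitely many positions, so it would already occur in a single graph
  \<open>E N\<close>. These are the instances of Los's theorem that the argument needs.\<close>

theorem bounded_path_length:
  "\<exists>N. \<forall>(E :: 'a \<Rightarrow> 'a \<Rightarrow> bool) W ps. simple_graph E \<and> P6_free E W \<and> K23_free E W \<and> clique_free E w W \<and>
      path_in E W ps \<longrightarrow> length ps \<le> N"
proof (rule ccontr)
  let ?bad = "\<lambda>N (E :: 'a \<Rightarrow> 'a \<Rightarrow> bool) W ps. simple_graph E \<and> P6_free E W \<and> K23_free E W \<and>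
      clique_free E w W \<and> path_in E W ps \<and> N < length ps"
  assume "\<not> ?thesis"
  then have "\<forall>N. \<exists>E W ps. ?bad N E W ps" by (metis not_le)
  then obtain E W p where *: "\<And>N. ?bad N (E N) (W N) (p N)" by metis
  obtain F :: "nat filter" where proper: "F \<noteq> bot" and free: "F \<le> sequentially"
    and ultra: "\<And>P. eventually P F \<or> eventually (\<lambda>x. \<not> P x) F"
    using ultrafilter_exists[of sequentially] by auto
  \<comment> \<open>Position \<open>c\<close> is guaranteed to exist on \<open>p N\<close> only for
    \<open>N\<close> above \<open>c\<close>; this holds for almost all \<open>N\<close> because
    \<open>F\<close> refines \<open>sequentially\<close>.\<close>
  have large: "eventually (\<lambda>N. c < N) F" for c :: nat
    using free eventually_gt_at_top filter_leD by blast
  define B where "B = (\<lambda>i j N. E N (p N ! i) (p N ! j))"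
  define A where "A = (\<lambda>i j. eventually (B i j) F)"
  \<comment> \<open>Negation commutes with the limit. This lets the nonedges of induced
    configurations transfer as well as their edges.\<close>
  have nA: "\<not> A i j \<longleftrightarrow> eventually (\<lambda>N. \<not> B i j N) F" for i j
  proof
    show "\<not> A i j \<Longrightarrow> eventually (\<lambda>N. \<not> B i j N) F" unfolding A_def using ultra by blast
    assume n: "eventually (\<lambda>N. \<not> B i j N) F"
    show "\<not> A i j"
    proof
      assume "A i j"
      then have "eventually (\<lambda>N. False) F" unfolding A_def using n by eventually_elim blast
      with proper show False by simp
    qed
  qed
  have inW: "c < N \<Longrightarrow> p N ! c \<in> W N" for c N
    using *[of N] unfolding path_in_def by (metis nth_mem order_less_trans subsetD)
  have inj: "i < N \<Longrightarrow> j < N \<Longrightarrow> i \<noteq> j \<Longrightarrow> p N ! i \<noteq> p N ! j" for i j N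
    using *[of N] unfolding path_in_def by (metis nth_eq_iff_index_eq order_less_trans)
  interpret generic_ray A F w
  proof
    show "A x y \<Longrightarrow> A y x" for x y
      unfolding A_def B_def using * by (auto simp: simple_graph_def elim: eventually_mono)
    show "\<not> A x x" for x
      unfolding nA B_def using * by (auto simp: simple_graph_def)
    show "A n (Suc n)" for n
      unfolding A_def B_def using large[of "Suc n"]
    proof eventually_elim
      case (elim N)
      then show ?case using *[of N] unfolding path_in_def successively_conv_nth by (meson order_less_trans)
    qed
    show "\<not> induced_P6 A a b c d e f" for a b c d e f
    proof
      assume "induced_P6 A a b c d e f"
      then have "eventually (\<lambda>N. induced_P6 (\<lambda>i j. B i j N) a b c d e f) F"
        unfolding induced_P6_def nA by (simp add: A_def eventually_conj_iff)
      with large[of a] large[of b] large[of c] large[of d] large[of e] large[of f]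
      have "eventually (\<lambda>N. False) F"
      proof eventually_elim
        case (elim N)
        then have "induced_P6 (E N) (p N ! a) (p N ! b) (p N ! c) (p N ! d) (p N ! e) (p N ! f)"
          by (simp add: induced_P6_def B_def)
        moreover have "P6_free (E N) (W N)" using *[of N] by blast
        ultimately show ?case using elim inW P6_freeD by metis
      qed
      with proper show False by simp
    qed
    show "\<not> induced_K23 A a a' b b' b''" for a a' b b' b''
    proof
      assume K: "induced_K23 A a a' b b' b''"
      then have "eventually (\<lambda>N. induced_K23 (\<lambda>i j. B i j N) a a' b b' b'') F"
        unfolding induced_K23_def nA by (simp add: A_def eventually_conj_iff)
      with large[of a] large[of a'] large[of b] large[of b'] large[of b'']
      have "eventually (\<lambda>N. False) F"
      proof eventually_elim
        case (elim N)
        then have "induced_K23 (E N) (p N ! a) (p N ! a') (p N ! b) (p N ! b') (p N ! b'')"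
          using inj[of _ N] by (simp add: induced_K23_def B_def)
        moreover have "K23_free (E N) (W N)" using *[of N] by blast
        ultimately show ?case using elim inW K23_freeD by metis
      qed
      with proper show False by simp
    qed
    show "clique_free A w UNIV"
      unfolding clique_free_def
    proof (intro allI impI, rule ccontr)
      fix S :: "nat set" assume S: "finite S \<and> card S = w"
        and n: "\<not> (\<exists>u\<in>S. \<exists>v\<in>S. u \<noteq> v \<and> \<not> A u v)"
      have "eventually (\<lambda>N. \<forall>u\<in>S. \<forall>v\<in>S. u \<noteq> v \<longrightarrow> B u v N) F"
        using S n by (intro eventually_ball_finite ballI) (auto simp: A_def)
      moreover have "eventually (\<lambda>N. \<forall>u\<in>S. u < N) F"
        using S large by (intro eventually_ball_finite) auto
      ultimately have "eventually (\<lambda>N. False) F"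
      proof eventually_elim
        case (elim N)
        have "inj_on ((!) (p N)) S" using elim inj by (meson inj_onI)
        then have "card ((!) (p N) ` S) = w" using S card_image by blast
        moreover have "(!) (p N) ` S \<subseteq> W N" using elim inW by blast
        ultimately obtain u v where "u \<in> S" "v \<in> S" "p N ! u \<noteq> p N ! v" "\<not> E N (p N ! u) (p N ! v)"
          using *[of N] S unfolding clique_free_def by (smt (verit) finite_imageI imageE)
        with elim show ?case unfolding B_def by metis
      qed
      with proper show False by simp
    qed
    show "F \<noteq> bot" by fact
    show "eventually (\<lambda>x. x \<noteq> c) F" for c using large[of c] by (auto elim: eventually_mono)
    show "eventually P F \<or> eventually (\<lambda>x. \<not> P x) F" for P by (rule ultra)
  qed
  show False by (rule contradiction)
qed

section \<open>Modules in banner-free graphs\<close>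

definition banner_free :: "('a \<Rightarrow> 'a \<Rightarrow> bool) \<Rightarrow> 'a set \<Rightarrow> bool" where
  "banner_free E W \<longleftrightarrow>
     (\<forall>a\<in>W. \<forall>b\<in>W. \<forall>c\<in>W. \<forall>d\<in>W. \<forall>v\<in>W.
        \<not> (a \<noteq> c \<and> b \<noteq> d \<and> E a b \<and> E b c \<and> E c d \<and> E d a \<and> \<not> E a c \<and> \<not> E b d \<and>
           E v a \<and> \<not> E v b \<and> \<not> E v c \<and> \<not> E v d))"

definition is_module :: "('a \<Rightarrow> 'a \<Rightarrow> bool) \<Rightarrow> 'a set \<Rightarrow> 'a set \<Rightarrow> bool" where
  "is_module E W X \<longleftrightarrow> X \<subseteq> W \<and> (\<forall>z\<in>W - X. (\<exists>x\<in>X. E z x) \<longrightarrow> (\<forall>x\<in>X. E z x))"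

text \<open>Connectedness of the complement, stated by cuts: every split of \<open>X\<close>
  directly yields a nonadjacent pair across it.\<close>

definition anticonnected :: "('a \<Rightarrow> 'a \<Rightarrow> bool) \<Rightarrow> 'a set \<Rightarrow> bool" where
  "anticonnected E X \<longleftrightarrow> (\<forall>Y\<subseteq>X. Y \<noteq> {} \<and> Y \<noteq> X \<longrightarrow> (\<exists>y\<in>Y. \<exists>z\<in>X - Y. \<not> E y z))"

text \<open>The dominating vertex extends every clique of \<open>X\<close>, so the clique number
  drops on \<open>X\<close>. Anticonnectedness ensures that overlapping modules of this kind can be
  merged with the domination intact.\<close>

definition dominated_module :: "('a \<Rightarrow> 'a \<Rightarrow> bool) \<Rightarrow> 'a set \<Rightarrow> 'a set \<Rightarrow> bool" where
  "dominated_module E W X \<longleftrightarrow>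
     X \<noteq> {} \<and> is_module E W X \<and> anticonnected E X \<and> (\<exists>a\<in>W. \<forall>x\<in>X. E a x)"

definition anticomponent :: "('a \<Rightarrow> 'a \<Rightarrow> bool) \<Rightarrow> 'a set \<Rightarrow> 'a \<Rightarrow> 'a set" where
  "anticomponent E C b = {(x, y). x \<in> C \<and> y \<in> C \<and> \<not> E x y}\<^sup>* `` {b}"

text \<open>On a finite graph this is the largest dominated module around \<open>v\<close>, or
  \<open>{v}\<close> if there is none. Since overlapping dominated modules merge, the classes
  partition the vertices.\<close>

definition class_of :: "('a \<Rightarrow> 'a \<Rightarrow> bool) \<Rightarrow> 'a set \<Rightarrow> 'a \<Rightarrow> 'a set" where
  "class_of E W v = insert v (\<Union>{X. dominated_module E W X \<and> v \<in> X})"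

lemma banner_freeD:
  "banner_free E W \<Longrightarrow> a \<in> W \<Longrightarrow> b \<in> W \<Longrightarrow> c \<in> W \<Longrightarrow> d \<in> W \<Longrightarrow> v \<in> W \<Longrightarrow>
    a \<noteq> c \<Longrightarrow> b \<noteq> d \<Longrightarrow> E a b \<Longrightarrow> E b c \<Longrightarrow> E c d \<Longrightarrow> E d a \<Longrightarrow> \<not> E a c \<Longrightarrow> \<not> E b d \<Longrightarrow>
    E v a \<Longrightarrow> \<not> E v b \<Longrightarrow> \<not> E v c \<Longrightarrow> \<not> E v d \<Longrightarrow> False"
  unfolding banner_free_def by blast

lemma anticonnectedD:
  "anticonnected E X \<Longrightarrow> Y \<subseteq> X \<Longrightarrow> Y \<noteq> {} \<Longrightarrow> Y \<noteq> X \<Longrightarrow> \<exists>y\<in>Y. \<exists>z\<in>X - Y. \<not> E y z"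
  unfolding anticonnected_def by blast

lemma anticomponent_subset: "b \<in> C \<Longrightarrow> anticomponent E C b \<subseteq> C"
  unfolding anticomponent_def by (auto elim: rtranclE)

lemma anticomponent_self: "b \<in> anticomponent E C b"
  unfolding anticomponent_def by simp

lemma anticomponent_step:
  "x \<in> anticomponent E C b \<Longrightarrow> x \<in> C \<Longrightarrow> y \<in> C \<Longrightarrow> \<not> E x y \<Longrightarrow> y \<in> anticomponent E C b"
  unfolding anticomponent_def by (auto intro: rtrancl_into_rtrancl)

lemma anticonnected_anticomponent:
  assumes sym: "\<And>x y. E x y \<Longrightarrow> E y x" and "b \<in> C"
  shows "anticonnected E (anticomponent E C b)"
  unfolding anticonnected_def
proof (intro allI impI, rule ccontr)
  fix Y
  let ?X = "anticomponent E C b"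
  assume Y: "Y \<subseteq> ?X" "Y \<noteq> {} \<and> Y \<noteq> ?X"
    and join: "\<not> (\<exists>y\<in>Y. \<exists>z\<in>?X - Y. \<not> E y z)"
  have same_side: "y \<in> ?X \<and> (y \<in> Y \<longleftrightarrow> b \<in> Y)"
    if "(b, y) \<in> {(x, y). x \<in> C \<and> y \<in> C \<and> \<not> E x y}\<^sup>*" for y
    using that
  proof induction
    case base
    show ?case by (simp add: anticomponent_self)
  next
    case (step y z)
    then have z: "z \<in> ?X" using anticomponent_step[of y E C b z] by simp
    with step join sym show ?case by blast
  qed
  have "\<And>y. y \<in> ?X \<Longrightarrow> y \<in> Y \<longleftrightarrow> b \<in> Y"
    using same_side unfolding anticomponent_def by blast
  with Y show False by blast
qed

lemma anticonnected_Un: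
  assumes "anticonnected E X" "anticonnected E X'" "c \<in> X" "c \<in> X'"
    and sym: "\<And>x y. E x y \<Longrightarrow> E y x"
  shows "anticonnected E (X \<union> X')"
  unfolding anticonnected_def
proof (intro allI impI)
  fix Y assume Y: "Y \<subseteq> X \<union> X'" "Y \<noteq> {} \<and> Y \<noteq> X \<union> X'"
  have split: "\<exists>y\<in>Y. \<exists>z\<in>X \<union> X' - Y. \<not> E y z"
    if "anticonnected E Z" "Z \<subseteq> X \<union> X'" "Z \<inter> Y \<noteq> {}" "\<not> Z \<subseteq> Y" for Z
  proof -
    have "\<exists>y\<in>Z \<inter> Y. \<exists>z\<in>Z - Z \<inter> Y. \<not> E y z"
      using that by (intro anticonnectedD) auto
    with that(2) show ?thesis by blast
  qed
  consider "X \<inter> Y \<noteq> {}" "\<not> X \<subseteq> Y" | "X' \<inter> Y \<noteq> {}" "\<not> X' \<subseteq> Y"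
    using Y assms(3,4) by blast
  then show "\<exists>y\<in>Y. \<exists>z\<in>X \<union> X' - Y. \<not> E y z"
    using split[OF assms(1)] split[OF assms(2)] by cases auto
qed

lemma is_module_Un:
  assumes "is_module E W X" "is_module E W X'" "c \<in> X" "c \<in> X'"
  shows "is_module E W (X \<union> X')"
  using assms unfolding is_module_def by blast

text \<open>A vertex \<open>a\<close> dominating \<open>X\<close> serves for the union. If
  \<open>a\<close> were in \<open>X'\<close>, each vertex of \<open>X - X'\<close> would see
  \<open>a\<close> and hence all of \<open>X'\<close>, so \<open>X\<close> would split into two
  completely joined parts. Thus \<open>a\<close> is outside \<open>X'\<close>, sees
  \<open>c\<close>, and so sees all of \<open>X'\<close>.\<close>

lemma dominated_module_Un:
  assumes G: "simple_graph E"
    and X: "dominated_module E W X" and X': "dominated_module E W X'" and c: "c \<in> X" "c \<in> X'"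
  shows "dominated_module E W (X \<union> X')"
proof (cases "X \<subseteq> X'")
  case True
  then have "X \<union> X' = X'" by blast
  with X' show ?thesis by simp
next
  case False
  note sym = simple_graph_sym[OF G]
  from X X' have mod: "is_module E W X" "is_module E W X'" and anti: "anticonnected E X" "anticonnected E X'"
    by (auto simp: dominated_module_def)
  obtain a where a: "a \<in> W" "\<And>x. x \<in> X \<Longrightarrow> E a x" using X by (auto simp: dominated_module_def)
  have "a \<notin> X'"
  proof
    assume "a \<in> X'"
    have join: "E u v" if "u \<in> X - X'" "v \<in> X'" for u v
    proof -
      have "E u a" using a sym that by blast
      moreover have "u \<in> W" using mod(1) that by (auto simp: is_module_def)
      ultimately show ?thesis using mod(2) that \<open>a \<in> X'\<close> unfolding is_module_def by blast
    qed
    have "\<exists>y\<in>X - X'. \<exists>z\<in>X - (X - X'). \<not> E y z"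
      by (rule anticonnectedD[OF anti(1)]) (use False c in auto)
    with join show False by blast
  qed
  then have "E a x" if "x \<in> X'" for x
    using mod(2) a c that unfolding is_module_def by blast
  with a have "\<exists>a\<in>W. \<forall>x\<in>X \<union> X'. E a x" by blast
  then show ?thesis
    using c is_module_Un[OF mod c] anticonnected_Un[OF anti c sym] by (auto simp: dominated_module_def)
qed

lemma class_of_self: "v \<in> class_of E W v"
  by (simp add: class_of_def)

lemma class_of_cases:
  assumes "simple_graph E" "finite W"
  shows "class_of E W v = {v} \<or> dominated_module E W (class_of E W v)"
proof (cases "{X. dominated_module E W X \<and> v \<in> X} = {}")
  case True
  show ?thesis unfolding class_of_def True by simp
next
  case False
  let ?D = "{X. dominated_module E W X \<and> v \<in> X}"
  have "?D \<subseteq> Pow W" by (auto simp: dominated_module_def is_module_def)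
  then have fin: "finite ?D" using \<open>finite W\<close> by (simp add: finite_subset)
  have "dominated_module E W (\<Union>S) \<and> v \<in> \<Union>S" if "finite S" "S \<noteq> {}" "S \<subseteq> ?D" for S
    using that
  proof (induction rule: finite_ne_induct)
    case (insert X S)
    then show ?case using dominated_module_Un[OF assms(1), of W X "\<Union>S" v] by simp
  qed simp
  from this[OF fin False] show ?thesis unfolding class_of_def by (auto simp: insert_absorb)
qed

lemma dominated_module_subset_class:
  "dominated_module E W X \<Longrightarrow> v \<in> X \<Longrightarrow> X \<subseteq> class_of E W v"
  unfolding class_of_def by blast

lemma class_of_eq:
  assumes "simple_graph E" "finite W" and y: "y \<in> class_of E W v"
  shows "class_of E W y = class_of E W v"
proof (cases "class_of E W v = {v}")
  case True
  with y show ?thesis by simp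
next
  case False
  then have v: "dominated_module E W (class_of E W v)" using class_of_cases[OF assms(1,2)] by blast
  have sub: "class_of E W v \<subseteq> class_of E W y" by (rule dominated_module_subset_class[OF v y])
  have "class_of E W y \<noteq> {y}" 
    using sub False class_of_self[of v E W] by (metis subset_singletonD singletonD emptyE)
  then have "dominated_module E W (class_of E W y)" using class_of_cases[OF assms(1,2)] by blast
  then have "class_of E W y \<subseteq> class_of E W v"
    by (rule dominated_module_subset_class) (use sub class_of_self[of v E W] in blast)
  with sub show ?thesis by blast
qed

lemma class_of_module:
  assumes "simple_graph E" "finite W" "v \<in> W"
  shows "is_module E W (class_of E W v)"
  using class_of_cases[OF assms(1,2), of v]
proof
  assume "class_of E W v = {v}"
  then show ?thesis using \<open>v \<in> W\<close> by (simp add: is_module_def)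
qed (simp add: dominated_module_def)

section \<open>Anticomponents of common neighbourhoods\<close>

locale banner_free_graph =
  fixes E :: "'a \<Rightarrow> 'a \<Rightarrow> bool" and W :: "'a set"
  assumes graph: "simple_graph E" and banner_free: "banner_free E W"
begin

lemma sym: "E x y \<Longrightarrow> E y x"
  by (rule simple_graph_sym[OF graph])

lemma irrefl: "\<not> E x x"
  by (rule simple_graph_irrefl[OF graph])

definition independent3 :: "'a \<Rightarrow> 'a \<Rightarrow> 'a \<Rightarrow> bool" where
  "independent3 s t u \<longleftrightarrow> s \<noteq> t \<and> s \<noteq> u \<and> t \<noteq> u \<and> \<not> E s t \<and> \<not> E s u \<and> \<not> E t u"

lemma independent3_perm:
  "independent3 s t u \<Longrightarrow> independent3 t s u" "independent3 s t u \<Longrightarrow> independent3 s u t"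
  unfolding independent3_def by (metis sym)+

text \<open>Otherwise some \<open>x\<close> with this property is nonadjacent to some
  \<open>y\<close> without it, and \<open>y\<close> is complete to all independent triples. Let
  \<open>x\<close> miss \<open>r\<close> in the triple \<open>r\<close>, \<open>s\<close>,
  \<open>t\<close>. Then \<open>x\<close> sees \<open>s\<close> and \<open>t\<close>, as otherwise
  \<open>x\<close> itself would lie in an independent triple. So \<open>y s x t\<close> is a 4-cycle
  with \<open>r\<close> pendant at \<open>y\<close>.\<close>

lemma near_independent3:
  assumes X: "X \<subseteq> W" "anticonnected E X"
    and t: "r \<in> X" "s \<in> X" "t \<in> X" "independent3 r s t" and "x \<in> X"
  shows "\<exists>r\<in>X. \<exists>s\<in>X. \<exists>t\<in>X. independent3 r s t \<and> \<not> E x r"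
proof (rule ccontr)
  let ?Y = "{y\<in>X. \<exists>r\<in>X. \<exists>s\<in>X. \<exists>t\<in>X. independent3 r s t \<and> \<not> E y r}"
  assume "\<not> ?thesis"
  then have "?Y \<noteq> X" using \<open>x \<in> X\<close> by blast
  moreover have "r \<in> ?Y" using t irrefl by blast
  ultimately obtain x y where x: "x \<in> ?Y" and y: "y \<in> X" "y \<notin> ?Y" and "\<not> E x y"
    using anticonnectedD[OF X(2), of ?Y] by blast
  then have "\<not> E y x" using sym by blast
  have complete: "E y r" if "r \<in> X" "s \<in> X" "t \<in> X" "independent3 r s t" for r s t
    using y that by blast
  from x obtain r s t where x: "x \<in> X" and t: "r \<in> X" "s \<in> X" "t \<in> X" "independent3 r s t" "\<not> E x r"
    by blast
  have yt: "E y r" "E y s" "E y t"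
    using complete[of r s t] complete[of s r t] complete[of t r s] t independent3_perm by blast+
  then have ne: "x \<noteq> r" "x \<noteq> s" "x \<noteq> t" "x \<noteq> y" using \<open>\<not> E y x\<close> \<open>\<not> E x r\<close> by blast+
  have "E x s"
  proof (rule ccontr)
    assume "\<not> E x s"
    then have "independent3 x r s" using t ne unfolding independent3_def by simp
    with complete[of x r s] x t \<open>\<not> E y x\<close> show False by blast
  qed
  moreover have "E x t"
  proof (rule ccontr)
    assume "\<not> E x t"
    then have "independent3 x r t" using t ne unfolding independent3_def by simp
    with complete[of x r t] x t \<open>\<not> E y x\<close> show False by blast
  qed
  ultimately show False
    using banner_freeD[OF banner_free, of y s x t r] X(1) x t y(1) ne yt sym \<open>\<not> E y x\<close>
    unfolding independent3_def by blast
qed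

text \<open>Members of triples come first. If \<open>z\<close> misses \<open>r\<close>, the cycles
  \<open>a r a' s\<close> and \<open>a r a' t\<close> with \<open>z\<close> attached to
  \<open>a\<close> force \<open>z\<close> to see \<open>s\<close> and \<open>t\<close>, and then
  \<open>r\<close> is pendant at \<open>a'\<close> of the cycle \<open>a' s z t\<close>. For other
  \<open>x\<close>, take a triple whose member \<open>r\<close> is nonadjacent to \<open>x\<close>:
  if \<open>z\<close> missed \<open>x\<close>, then \<open>r\<close> would be pendant at
  \<open>z\<close> of the cycle \<open>z s x t\<close>.\<close>

lemma half_adjacent_complete:
  assumes X: "X \<subseteq> W" "anticonnected E X"
    and t: "r \<in> X" "s \<in> X" "t \<in> X" "independent3 r s t"
    and a: "a \<in> W" "a' \<in> W" "a \<noteq> a'" "\<not> E a a'" "\<And>x. x \<in> X \<Longrightarrow> E a x" "\<And>x. x \<in> X \<Longrightarrow> E a' x"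
    and z: "z \<in> W" "E z a" "\<not> E z a'" and "x \<in> X"
  shows "E z x"
proof -
  note XW = subsetD[OF X(1)]
  have complete: "E z r" if t: "r \<in> X" "s \<in> X" "t \<in> X" "independent3 r s t" for r s t
  proof (rule ccontr)
    assume r: "\<not> E z r"
    have s: "E z s"
      using banner_freeD[OF banner_free, of a r a' s z] XW t a z r sym
      unfolding independent3_def by blast
    have t': "E z t"
      using banner_freeD[OF banner_free, of a r a' t z] XW t a z r sym
      unfolding independent3_def by blast
    have "a' \<noteq> z" using a(6)[of r] t(1) r by blast
    with banner_freeD[OF banner_free, of a' s z t r] XW t a z r s t' sym
    show False unfolding independent3_def by blast
  qed
  obtain r s t where t: "r \<in> X" "s \<in> X" "t \<in> X" "independent3 r s t" "\<not> E x r"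
    using near_independent3[OF X t \<open>x \<in> X\<close>] by blast
  have zt: "E z r" "E z s" "E z t"
    using complete[of r s t] complete[of s r t] complete[of t r s] t independent3_perm by blast+
  show ?thesis
  proof (rule ccontr)
    assume n: "\<not> E z x"
    then have ne: "x \<noteq> r" "x \<noteq> s" "x \<noteq> t" using zt by blast+
    have "z \<noteq> x" using zt t by blast
    have "E x s"
    proof (rule ccontr)
      assume "\<not> E x s"
      then have "independent3 x r s" using t ne unfolding independent3_def by simp
      with complete[of x r s] \<open>x \<in> X\<close> t n show False by blast
    qed
    moreover have "E x t"
    proof (rule ccontr)
      assume "\<not> E x t"
      then have "independent3 x r t" using t ne unfolding independent3_def by simp
      with complete[of x r t] \<open>x \<in> X\<close> t n show False by blast
    qed
    ultimately show False
      using banner_freeD[OF banner_free, of z s x t r] XW \<open>x \<in> X\<close> t z ne zt sym n \<open>z \<noteq> x\<close>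
      unfolding independent3_def by blast
  qed
qed

text \<open>Suppose an outside vertex \<open>z\<close> distinguishes members of the anticomponent.
  It cannot see both \<open>a\<close> and \<open>a'\<close>, for then it would belong to the
  anticomponent. Some nonadjacent \<open>y\<close>, \<open>y'\<close> are distinguished by
  \<open>z\<close>; seeing neither \<open>a\<close> nor \<open>a'\<close> would make
  \<open>z\<close> pendant at \<open>y\<close> of the cycle \<open>y a y' a'\<close>. Seeing exactly
  one is excluded by \<open>half_adjacent_complete\<close>.\<close>

lemma anticomponent_dominated_module:
  assumes a: "a \<in> W" "a' \<in> W" "a \<noteq> a'" "\<not> E a a'"
    and t: "r \<in> W" "s \<in> W" "t \<in> W" "independent3 r s t"
    and adj: "E a r" "E a s" "E a t" "E a' r" "E a' s" "E a' t"
  obtains X where "dominated_module E W X" "r \<in> X" "s \<in> X"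
proof -
  let ?C = "{x\<in>W. E a x \<and> E a' x}"
  let ?X = "anticomponent E ?C r"
  have rC: "r \<in> ?C" "s \<in> ?C" "t \<in> ?C" using t adj by auto
  have XC: "?X \<subseteq> ?C" by (rule anticomponent_subset[OF rC(1)])
  have rX: "r \<in> ?X" by (rule anticomponent_self)
  have sX: "s \<in> ?X" and tX: "t \<in> ?X"
    using anticomponent_step[OF rX rC(1)] rC t(4) unfolding independent3_def by blast+
  have anti: "anticonnected E ?X" by (rule anticonnected_anticomponent[OF sym rC(1)])
  have XW: "?X \<subseteq> W" using XC by blast
  have aX: "\<And>x. x \<in> ?X \<Longrightarrow> E a x" "\<And>x. x \<in> ?X \<Longrightarrow> E a' x" using XC by blast+
  have "E z q" if z: "z \<in> W - ?X" and p: "p \<in> ?X" "E z p" and q: "q \<in> ?X" for z p q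
  proof (rule ccontr)
    assume "\<not> E z q"
    let ?Y = "{y\<in>?X. E z y}"
    have "\<exists>y\<in>?Y. \<exists>y'\<in>?X - ?Y. \<not> E y y'"
      by (rule anticonnectedD[OF anti]) (use p q \<open>\<not> E z q\<close> in auto)
    then obtain y y' where y: "y \<in> ?X" "y' \<in> ?X" "E z y" "\<not> E z y'" "\<not> E y y'" by blast
    have "\<not> (E a z \<and> E a' z)"
    proof
      assume "E a z \<and> E a' z"
      then have "z \<in> ?C" using z by blast
      then have "\<not> E q z \<Longrightarrow> z \<in> ?X" using anticomponent_step[OF q] XC q by blast
      with z sym \<open>\<not> E z q\<close> show False by blast
    qed
    moreover have "E z a \<or> E z a'"
      using banner_freeD[OF banner_free, of y a y' a' z] XW aX a y z sym by blast
    ultimately consider "E z a" "\<not> E z a'" | "E z a'" "\<not> E z a" using sym by blast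
    then show False
    proof cases
      case 1
      with half_adjacent_complete[OF XW anti rX sX tX t(4) a aX _ 1 q] z \<open>\<not> E z q\<close> show False by blast
    next
      case 2
      have "a' \<noteq> a" "\<not> E a' a" using a sym by blast+
      with half_adjacent_complete[OF XW anti rX sX tX t(4) a(2,1) _ _ aX(2,1) _ 2 q] z \<open>\<not> E z q\<close>
      show False by blast
    qed
  qed
  then have "is_module E W ?X" using XW unfolding is_module_def by blast
  then have "dominated_module E W ?X"
    using rX anti aX(1) a(1) unfolding dominated_module_def by blast
  with rX sX that show ?thesis by blast
qed

text \<open>The independent triple of an induced \<open>K23\<close> meets a single dominated module
  at least twice, that is, a single class.\<close>

lemma transversal_K23_free:
  assumes "finite W" "H \<subseteq> W"
    and inj: "\<And>x y. x \<in> H \<Longrightarrow> y \<in> H \<Longrightarrow> class_of E W x = class_of E W y \<Longrightarrow> x = y"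
  shows "K23_free E H"
  unfolding K23_free_def
proof (intro ballI notI)
  fix a a' b b' b'' assume H: "a \<in> H" "a' \<in> H" "b \<in> H" "b' \<in> H" "b'' \<in> H"
    and K: "induced_K23 E a a' b b' b''"
  then have W: "a \<in> W" "a' \<in> W" "b \<in> W" "b' \<in> W" "b'' \<in> W" using \<open>H \<subseteq> W\<close> by auto
  have "independent3 b b' b''" using K unfolding independent3_def induced_K23_def by blast
  then obtain X where X: "dominated_module E W X" "b \<in> X" "b' \<in> X"
    using anticomponent_dominated_module[OF W(1,2) _ _ W(3-5)] K unfolding induced_K23_def by blast
  then have "b' \<in> class_of E W b" using dominated_module_subset_class by fast
  then have "class_of E W b' = class_of E W b" using class_of_eq[OF graph \<open>finite W\<close>] by blast
  with inj H K show False unfolding induced_K23_def by blast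
qed

end

section \<open>The coloring game\<close>

text \<open>
  In each round the spoiler picks a vertex of \<open>W\<close> and the duplicator answers with a color from \<open>P\<close>;
  the duplicator loses as soon as two adjacent picks have the same color. The set \<open>ps\<close> contains the
  picks made so far.
\<close>

definition consistent :: "('a \<Rightarrow> 'a \<Rightarrow> bool) \<Rightarrow> ('a \<times> 'c) set \<Rightarrow> bool" where
  "consistent E ps \<longleftrightarrow> (\<forall>(u, c)\<in>ps. \<forall>(v, d)\<in>ps. E u v \<longrightarrow> c \<noteq> d)"

primrec wins ::
  "('a \<Rightarrow> 'a \<Rightarrow> bool) \<Rightarrow> 'a set \<Rightarrow> 'c set \<Rightarrow> nat \<Rightarrow> ('a \<times> 'c) set \<Rightarrow> bool" where
  "wins E W P 0 ps \<longleftrightarrow> consistent E ps"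
| "wins E W P (Suc q) ps \<longleftrightarrow> consistent E ps \<and> (\<forall>v\<in>W. \<exists>c\<in>P. wins E W P q (insert (v, c) ps))"

definition set_colorable :: "('a \<Rightarrow> 'a \<Rightarrow> bool) \<Rightarrow> 'a set \<Rightarrow> 'c set \<Rightarrow> bool" where
  "set_colorable E M Q \<longleftrightarrow> (\<exists>f. (\<forall>v\<in>M. f v \<in> Q) \<and> (\<forall>u\<in>M. \<forall>v\<in>M. E u v \<longrightarrow> f u \<noteq> f v))"

lemma consistent_mono: "consistent E ps \<Longrightarrow> ps' \<subseteq> ps \<Longrightarrow> consistent E ps'"
  unfolding consistent_def by blast

lemma consistentD: "consistent E ps \<Longrightarrow> (u, c) \<in> ps \<Longrightarrow> (v, d) \<in> ps \<Longrightarrow> E u v \<Longrightarrow> c \<noteq> d"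
  unfolding consistent_def by blast

lemma wins_consistent: "wins E W P q ps \<Longrightarrow> consistent E ps"
  by (cases q) auto

lemma wins_mono_rounds: "wins E W P q ps \<Longrightarrow> q' \<le> q \<Longrightarrow> wins E W P q' ps"
proof (induction q arbitrary: q' ps)
  case (Suc q)
  note IH = Suc.IH and win = Suc.prems(1) and le = Suc.prems(2)
  show ?case
  proof (cases q')
    case 0
    then show ?thesis using win by simp
  next
    case (Suc r)
    then have "r \<le> q" using le by simp
    then have "\<forall>v\<in>W. \<exists>c\<in>P. wins E W P r (insert (v, c) ps)"
      using win IH[of _ r] unfolding wins.simps by blast
    with win Suc show ?thesis by simp
  qed
qed simp

lemma colorable_wins:
  assumes "\<And>v. v \<in> W \<Longrightarrow> f v \<in> P" "\<And>u v. u \<in> W \<Longrightarrow> v \<in> W \<Longrightarrow> E u v \<Longrightarrow> f u \<noteq> f v"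
    and "ps \<subseteq> (\<lambda>v. (v, f v)) ` W"
  shows "wins E W P q ps"
  using assms(3)
proof (induction q arbitrary: ps)
  have cons: "consistent E ps" if ps: "ps \<subseteq> (\<lambda>v. (v, f v)) ` W" for ps
  proof -
    have "c \<noteq> d" if "(u, c) \<in> ps" "(v, d) \<in> ps" "E u v" for u c v d
    proof -
      have "u \<in> W" "c = f u" "v \<in> W" "d = f v" using ps that(1,2) by auto
      with assms(2) that(3) show ?thesis by blast
    qed
    then show ?thesis unfolding consistent_def by auto
  qed
  {
    case 0
    with cons show ?case by simp
  next
    case (Suc q)
    have "consistent E ps" using cons Suc.prems .
    moreover have "wins E W P q (insert (v, f v) ps)" if "v \<in> W" for v
      using Suc that by auto
    ultimately show ?case using assms(1) by auto
  }
qed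

text \<open>The spoiler follows a strategy that wins on \<open>M\<close> against the palette
  \<open>Q\<close>. Were all answers in \<open>Q\<close>, the position would become inconsistent
  within \<open>q\<close> rounds; so some answer leaves \<open>Q\<close>, with at least
  \<open>m\<close> rounds to spare. The set \<open>r\<close> holds the picks of this subgame among
  all picks \<open>ps\<close>.\<close>

lemma wins_avoid_palette:
  assumes "\<not> wins E M Q q r" "wins E W P (q + m) ps" "r \<subseteq> ps" "M \<subseteq> W"
  shows "\<exists>ps'\<subseteq>M \<times> P. wins E W P m (ps \<union> ps') \<and> \<not> snd ` ps' \<subseteq> Q"
  using assms
proof (induction q arbitrary: r ps)
  case 0
  then show ?case using wins_consistent consistent_mono by (metis wins.simps(1))
next
  case (Suc q)
  have "consistent E r" using Suc.prems(2,3) wins_consistent consistent_mono by blast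
  with Suc.prems(1) obtain v where v: "v \<in> M" and lose: "\<And>c. c \<in> Q \<Longrightarrow> \<not> wins E M Q q (insert (v, c) r)"
    by auto
  then obtain c where c: "c \<in> P" and win: "wins E W P (q + m) (insert (v, c) ps)"
    using Suc.prems(2,4) by (metis add_Suc subsetD wins.simps(2))
  show ?case
  proof (cases "c \<in> Q")
    case True
    have "\<exists>ps'\<subseteq>M \<times> P. wins E W P m (insert (v, c) ps \<union> ps') \<and> \<not> snd ` ps' \<subseteq> Q"
      by (rule Suc.IH[OF lose[OF True] win _ Suc.prems(4)]) (use Suc.prems(3) in auto)
    then obtain ps' where "ps' \<subseteq> M \<times> P" "wins E W P m (insert (v, c) ps \<union> ps')" "\<not> snd ` ps' \<subseteq> Q"
      by blast
    with v c show ?thesis by (intro exI[of _ "insert (v, c) ps'"]) auto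
  next
    case False
    have "wins E W P m (insert (v, c) ps)" using win by (rule wins_mono_rounds) simp
    with v c False show ?thesis by (intro exI[of _ "{(v, c)}"]) auto
  qed
qed

text \<open>All subpalettes are included because the spoiler plays against the set of colors
  exhibited so far, which can be any subset of \<open>P\<close>.\<close>

definition game_decides :: "('a \<Rightarrow> 'a \<Rightarrow> bool) \<Rightarrow> 'c set \<Rightarrow> nat \<Rightarrow> 'a set \<Rightarrow> bool" where
  "game_decides E P q M \<longleftrightarrow> (\<forall>Q\<subseteq>P. wins E M Q q {} \<longrightarrow> set_colorable E M Q)"

text \<open>
  By playing inside \<open>M\<close> only, the spoiler makes the duplicator use a set of colors that suffices to
  color \<open>M\<close>: as long as it does not, a losing palette must be left within \<open>q\<close> further rounds.
\<close>

lemma wins_expose: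
  assumes "finite P" "game_decides E P q M" "M \<subseteq> W"
    and "ps' \<subseteq> M \<times> P" "wins E W P (Suc (card (P - snd ` ps')) * q + m) (ps \<union> ps')"
  shows "\<exists>ps''\<subseteq>M \<times> P. wins E W P m (ps \<union> ps'') \<and> set_colorable E M (snd ` ps'')"
  using assms(4,5)
proof (induction "card (P - snd ` ps')" arbitrary: ps' rule: less_induct)
  case less
  show ?case
  proof (cases "set_colorable E M (snd ` ps')")
    case True
    have "wins E W P m (ps \<union> ps')" using less.prems(2) by (rule wins_mono_rounds) simp
    with True less.prems(1) show ?thesis by blast
  next
    case False
    let ?n = "card (P - snd ` ps')"
    have "snd ` ps' \<subseteq> P" using less.prems(1) by auto
    \<comment> \<open>This also covers the case that all of \<open>P\<close> is exhibited already.
      Refuting it takes \<open>q\<close> rounds too, hence the \<open>Suc\<close> in the number of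
      phases.\<close>
    then have lose: "\<not> wins E M (snd ` ps') q {}" using False assms(2) unfolding game_decides_def by blast
    have "wins E W P (q + (?n * q + m)) (ps \<union> ps')" using less.prems(2) by (simp add: add.assoc)
    from wins_avoid_palette[OF lose this _ assms(3)]
    obtain ps'' where ps'': "ps'' \<subseteq> M \<times> P" "wins E W P (?n * q + m) (ps \<union> ps' \<union> ps'')"
      "\<not> snd ` ps'' \<subseteq> snd ` ps'" by auto
    let ?ps = "ps' \<union> ps''"
    have sub: "?ps \<subseteq> M \<times> P" using less.prems(1) ps''(1) by blast
    have "snd ` ps'' \<subseteq> P" using ps''(1) by auto
    then have "P - snd ` ?ps \<subset> P - snd ` ps'" using ps''(3) unfolding image_Un by blast
    then have lt: "card (P - snd ` ?ps) < ?n" using assms(1) by (intro psubset_card_mono) auto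
    then have "Suc (card (P - snd ` ?ps)) * q \<le> ?n * q"
      by (intro mult_le_mono1 Suc_leI)
    then have "wins E W P (Suc (card (P - snd ` ?ps)) * q + m) (ps \<union> ps' \<union> ps'')"
      by (intro wins_mono_rounds[OF ps''(2)] add_le_mono1)
    then have "wins E W P (Suc (card (P - snd ` ?ps)) * q + m) (ps \<union> ?ps)" by (simp only: Un_assoc)
    from less.hyps[OF lt sub this] show ?thesis .
  qed
qed

section \<open>Reachability and components\<close>

definition reaches :: "('a \<Rightarrow> 'a \<Rightarrow> bool) \<Rightarrow> 'a set \<Rightarrow> 'a \<Rightarrow> 'a \<Rightarrow> bool" where
  "reaches E K u v \<longleftrightarrow> (u, v) \<in> {(x, y). x \<in> K \<and> y \<in> K \<and> E x y}\<^sup>*"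

lemma reaches_refl: "reaches E K u u"
  unfolding reaches_def by simp

lemma reaches_step: "reaches E K u v \<Longrightarrow> v \<in> K \<Longrightarrow> w \<in> K \<Longrightarrow> E v w \<Longrightarrow> reaches E K u w"
  unfolding reaches_def by (auto intro: rtrancl_into_rtrancl)

lemma reaches_trans: "reaches E K u v \<Longrightarrow> reaches E K v w \<Longrightarrow> reaches E K u w"
  unfolding reaches_def by (rule rtrancl_trans)

lemma reaches_sym:
  assumes "simple_graph E" "reaches E K u v"
  shows "reaches E K v u"
proof -
  from simple_graph_sym[OF assms(1)] have "sym {(x, y). x \<in> K \<and> y \<in> K \<and> E x y}"
    by (intro symI) (metis (no_types, lifting) case_prodD case_prodI mem_Collect_eq)
  from symD[OF sym_rtrancl[OF this]] assms(2) show ?thesis unfolding reaches_def by blast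
qed

definition component :: "('a \<Rightarrow> 'a \<Rightarrow> bool) \<Rightarrow> 'a set \<Rightarrow> 'a \<Rightarrow> 'a set" where
  "component E K u = {v\<in>K. reaches E K u v}"

lemma component_eq:
  assumes "simple_graph E" "reaches E K u v"
  shows "component E K u = component E K v"
  using assms(2) reaches_sym[OF assms] reaches_trans[of E K] unfolding component_def by blast

lemma component_connected:
  assumes "simple_graph E" "u \<in> K" "v \<in> component E K u" "w \<in> component E K u"
  shows "reaches E (component E K u) v w"
proof -
  have from_u: "reaches E (component E K u) u w" if "reaches E K u w" for w
    using that[unfolded reaches_def]
  proof induction
    case base
    show ?case by (rule reaches_refl)
  next
    case (step y z)
    have yz: "y \<in> K" "z \<in> K" "E y z" using step(2) by auto
    have y: "reaches E K u y" using step(1) unfolding reaches_def .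
    then have "reaches E K u z" using yz by (rule reaches_step)
    with y yz have "y \<in> component E K u" "z \<in> component E K u" by (simp_all add: component_def)
    with step.IH show ?case using yz(3) by (rule reaches_step)
  qed
  have "reaches E (component E K u) u v" "reaches E (component E K u) u w"
    using from_u assms(3,4) unfolding component_def by blast+
  then show ?thesis by (rule reaches_trans[OF reaches_sym[OF assms(1)]])
qed

text \<open>Along a walk from \<open>v\<close> to \<open>u\<close>, every return to \<open>v\<close>
  restarts the choice of \<open>v'\<close>, so \<open>v'\<close> is the vertex after the last visit
  to \<open>v\<close>.\<close>

lemma reaches_neighbour:
  assumes "simple_graph E" "reaches E K v u" "u \<in> K - {v}" "v \<in> K"
  shows "\<exists>v'\<in>K - {v}. E v v' \<and> reaches E (K - {v}) v' u"
  using assms(2)[unfolded reaches_def] assms(3)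
proof (induction)
  case base
  then show ?case by simp
next
  case (step y z)
  have yz: "y \<in> K" "z \<in> K" "E y z" using step(2) by auto
  show ?case
  proof (cases "y = v")
    case True
    with step.prems yz reaches_refl show ?thesis by metis
  next
    case False
    with step.IH yz obtain v' where v': "v' \<in> K - {v}" "E v v'" "reaches E (K - {v}) v' y" by blast
    have "reaches E (K - {v}) v' z" using v'(3) _ step.prems yz(3) by (rule reaches_step) (use False yz in simp)
    with v' show ?thesis by blast
  qed
qed

section \<open>Exploring a transversal of modules\<close>

locale module_transversal =
  fixes E :: "'a \<Rightarrow> 'a \<Rightarrow> bool" and W H :: "'a set" and M :: "'a \<Rightarrow> 'a set" and P :: "'c set" and q :: nat
  assumes graph: "simple_graph E" and finite_palette: "finite P"
    and M_subset: "h \<in> H \<Longrightarrow> M h \<subseteq> W"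
    and complete: "h \<in> H \<Longrightarrow> h' \<in> H \<Longrightarrow> E h h' \<Longrightarrow> x \<in> M h \<Longrightarrow> y \<in> M h' \<Longrightarrow> E x y"
    and decides: "h \<in> H \<Longrightarrow> game_decides E P q (M h)"
begin

text \<open>The clause on \<open>ps\<close> hands on the answers from modules visited earlier: a
  color given to \<open>x\<close> is barred from every module that \<open>x\<close> sees completely.
  It is the source of the disjointness of palettes between an earlier and a later module.\<close>

definition palette_solution :: "('a \<times> 'c) set \<Rightarrow> 'a set \<Rightarrow> ('a \<Rightarrow> 'c set) \<Rightarrow> bool" where
  "palette_solution ps K F \<longleftrightarrow>
     (\<forall>u\<in>K. F u \<subseteq> P \<and> set_colorable E (M u) (F u) \<and>
        (\<forall>(x, a)\<in>ps. (\<forall>y\<in>M u. E x y) \<longrightarrow> a \<notin> F u)) \<and>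
     (\<forall>u\<in>K. \<forall>v\<in>K. E u v \<longrightarrow> F u \<inter> F v = {})"

lemma glue_components:
  assumes "\<And>u. u \<in> K \<Longrightarrow> \<exists>F. palette_solution ps (component E K u) F"
  shows "\<exists>F. palette_solution ps K F"
proof -
  \<comment> \<open>The choice depends on the component as a set only, so all its vertices use the
    same solution.\<close>
  define G where "G C = (SOME F. palette_solution ps C F)" for C
  have G: "palette_solution ps (component E K u) (G (component E K u))" if "u \<in> K" for u
    unfolding G_def using assms[OF that] by (rule someI_ex)
  define F where "F u = G (component E K u) u" for u
  have self: "u \<in> component E K u" if "u \<in> K" for u
    using that reaches_refl by (auto simp: component_def)
  have "F u \<inter> F v = {}" if "u \<in> K" "v \<in> K" "E u v" for u v
  proof -
    have "reaches E K u v" using reaches_step[OF reaches_refl] that by metis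
    then have "component E K u = component E K v" "v \<in> component E K u"
      using component_eq[OF graph] that by (auto simp: component_def)
    then show ?thesis using G[OF that(1)] self[OF that(1)] that unfolding palette_solution_def F_def by auto
  qed
  then have "palette_solution ps K F"
    using G self unfolding palette_solution_def F_def by blast
  then show ?thesis by blast
qed

text \<open>Every component of \<open>K - {v}\<close> contains a neighbour of \<open>v\<close>, and
  paths starting there are shorter by one. All components continue from the same position
  \<open>ps \<union> ps'\<close>, so \<open>Suc (card P) * q\<close> rounds are spent per level of
  depth and not per module.\<close>

lemma connected_palette_solution:
  assumes "K \<subseteq> H" "v \<in> K" "\<And>u. u \<in> K \<Longrightarrow> reaches E K v u"
    and "\<And>vs. path_in E K (v # vs) \<Longrightarrow> length (v # vs) \<le> n"
    and "wins E W P (n * (Suc (card P) * q)) ps"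
  shows "\<exists>F. palette_solution ps K F"
  using assms
proof (induction n arbitrary: K v ps)
  case 0
  have "path_in E K [v]" using 0 by (simp add: path_in_def)
  with 0(4) show ?case by fastforce
next
  case (Suc n)
  have v: "v \<in> H" using Suc.prems by blast
  have "wins E W P (Suc (card (P - snd ` {})) * q + n * (Suc (card P) * q)) (ps \<union> {})"
    using Suc.prems(5) by simp
  from wins_expose[OF finite_palette decides[OF v] M_subset[OF v] _ this]
  obtain ps' where ps': "ps' \<subseteq> M v \<times> P" and win: "wins E W P (n * (Suc (card P) * q)) (ps \<union> ps')"
    and col: "set_colorable E (M v) (snd ` ps')" by auto
  have "\<exists>F. palette_solution (ps \<union> ps') (K - {v}) F"
  proof (rule glue_components)
    fix u assume u: "u \<in> K - {v}"
    let ?C = "component E (K - {v}) u"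
    obtain v' where v': "v' \<in> K - {v}" "E v v'" "reaches E (K - {v}) v' u"
      using reaches_neighbour[OF graph Suc.prems(3) u Suc.prems(2)] u by blast
    have C: "?C \<subseteq> K - {v}" by (auto simp: component_def)
    have v'C: "v' \<in> ?C" using v' reaches_sym[OF graph] by (auto simp: component_def)
    show "\<exists>F. palette_solution (ps \<union> ps') ?C F"
    proof (rule Suc.IH[OF _ v'C _ _ win])
      show "?C \<subseteq> H" using C Suc.prems(1) by blast
      show "\<And>w. w \<in> ?C \<Longrightarrow> reaches E ?C v' w" by (rule component_connected[OF graph u v'C])
      fix vs assume p: "path_in E ?C (v' # vs)"
      then have "path_in E K (v # v' # vs)"
        using C v' Suc.prems(2) unfolding path_in_def by auto
      from Suc.prems(4)[OF this] show "length (v' # vs) \<le> n" by simp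
    qed
  qed
  then obtain F where F: "palette_solution (ps \<union> ps') (K - {v}) F" by blast
  let ?F = "F(v := snd ` ps')"
  note sym = simple_graph_sym[OF graph] and irrefl = simple_graph_irrefl[OF graph]
  have new: "snd ` ps' \<inter> F u = {}" if u: "u \<in> K - {v}" "E v u" for u
  proof -
    have "a \<notin> F u" if "(x, a) \<in> ps'" for x a
    proof -
      have "x \<in> M v" using ps' that by blast
      then have "\<forall>y\<in>M u. E x y" using complete[OF v _ u(2)] u Suc.prems(1) by blast
      then show ?thesis using F u that unfolding palette_solution_def by blast
    qed
    then show ?thesis by auto
  qed
  \<comment> \<open>A color barred from \<open>M v\<close> was given to a vertex complete to
    \<open>M v\<close>. Repeating it inside \<open>M v\<close> would make the surviving position
    inconsistent.\<close>
  have old: "a \<notin> snd ` ps'" if xa: "(x, a) \<in> ps" "\<forall>y\<in>M v. E x y" for x a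
  proof
    assume "a \<in> snd ` ps'"
    then obtain y where y: "(y, a) \<in> ps'" by auto
    then have "E x y" using ps' xa by blast
    with consistentD[OF wins_consistent[OF win], of x a y a] xa y show False by blast
  qed
  have "palette_solution ps K ?F"
    unfolding palette_solution_def
  proof (intro conjI ballI impI)
    fix u assume "u \<in> K"
    show "?F u \<subseteq> P" using F ps' \<open>u \<in> K\<close> unfolding palette_solution_def by auto
    show "set_colorable E (M u) (?F u)" using F col \<open>u \<in> K\<close> unfolding palette_solution_def by auto
    fix xa assume "xa \<in> ps"
    then show "case xa of (x, a) \<Rightarrow> (\<forall>y\<in>M u. E x y) \<longrightarrow> a \<notin> ?F u"
      using F old \<open>u \<in> K\<close> unfolding palette_solution_def by (cases "u = v") auto
  next
    fix u w assume uw: "u \<in> K" "w \<in> K" "E u w"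
    consider "u = v" "w \<noteq> v" | "u \<noteq> v" "w = v" | "u \<noteq> v" "w \<noteq> v" using uw irrefl by blast
    then show "?F u \<inter> ?F w = {}"
    proof cases
      case 1
      then show ?thesis using new[of w] uw by simp
    next
      case 2
      then show ?thesis using new[of u] uw sym by (simp add: Int_commute)
    next
      case 3
      then show ?thesis using F uw unfolding palette_solution_def by simp
    qed
  qed
  then show ?case by blast
qed

lemma palette_solution_exists:
  assumes "\<And>vs. path_in E H vs \<Longrightarrow> length vs \<le> n" and "wins E W P (n * (Suc (card P) * q)) {}"
  shows "\<exists>F. palette_solution {} H F"
proof (rule glue_components)
  fix u assume u: "u \<in> H"
  let ?C = "component E H u"
  have C: "?C \<subseteq> H" "u \<in> ?C" using u reaches_refl by (auto simp: component_def)
  show "\<exists>F. palette_solution {} ?C F"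
  proof (rule connected_palette_solution[OF C _ _ assms(2)])
    show "\<And>w. w \<in> ?C \<Longrightarrow> reaches E ?C u w" by (rule component_connected[OF graph u C(2)])
    show "\<And>vs. path_in E ?C (u # vs) \<Longrightarrow> length (u # vs) \<le> n"
      using C(1) by (intro assms(1)) (auto simp: path_in_def)
  qed
qed

end

section \<open>Induction on the clique number\<close>

lemma clique_free_dominated:
  assumes "clique_free E (Suc w) W" "X \<subseteq> W" "a \<in> W" "\<And>x. x \<in> X \<Longrightarrow> E a x" "simple_graph E"
  shows "clique_free E w X"
  unfolding clique_free_def
proof (intro allI impI)
  fix S assume S: "S \<subseteq> X" "finite S \<and> card S = w"
  note sym = simple_graph_sym[OF assms(5)] and irrefl = simple_graph_irrefl[OF assms(5)]
  have "a \<notin> S" using S(1) assms(4) irrefl by blast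
  then have "card (insert a S) = Suc w" using S by simp
  moreover have "insert a S \<subseteq> W" "finite (insert a S)" using S assms(2,3) by auto
  ultimately have "\<exists>u\<in>insert a S. \<exists>v\<in>insert a S. u \<noteq> v \<and> \<not> E u v"
    using assms(1) unfolding clique_free_def by blast
  then show "\<exists>u\<in>S. \<exists>v\<in>S. u \<noteq> v \<and> \<not> E u v"
    using S(1) assms(4) sym by blast
qed

lemma P6_free_subset: "P6_free E W \<Longrightarrow> X \<subseteq> W \<Longrightarrow> P6_free E X"
  unfolding P6_free_def by blast

lemma banner_free_subset: "banner_free E W \<Longrightarrow> X \<subseteq> W \<Longrightarrow> banner_free E X"
  unfolding banner_free_def by (meson subsetD)

lemma clique_free_subset: "clique_free E w W \<Longrightarrow> X \<subseteq> W \<Longrightarrow> clique_free E w X"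
  unfolding clique_free_def by blast

lemma game_decides_mono: "game_decides E P q M \<Longrightarrow> q \<le> q' \<Longrightarrow> game_decides E P q' M"
  unfolding game_decides_def using wins_mono_rounds by blast

text \<open>One round is needed: with none, the duplicator wins even with the empty palette.\<close>

lemma game_decides_singleton:
  assumes "\<not> E v v"
  shows "game_decides E P (Suc 0) {v}"
  using assms by (auto simp: game_decides_def set_colorable_def)

theorem game_decides_clique_free:
  assumes "finite (P :: 'c set)"
  shows "\<exists>q. \<forall>(E :: 'a \<Rightarrow> 'a \<Rightarrow> bool) W. finite W \<and> simple_graph E \<and> P6_free E W \<and> banner_free E W \<and>
      clique_free E w W \<longrightarrow> game_decides E P q W"
proof (induction w)
  case 0
  \<comment> \<open>The empty set is a clique on 0 vertices in every graph, so the base case is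
    vacuous.\<close>
  have "\<not> clique_free E 0 W" for E :: "'a \<Rightarrow> 'a \<Rightarrow> bool" and W
    unfolding clique_free_def by auto
  then show ?case by blast
next
  case (Suc w)
  then obtain q where q: "\<And>(E :: 'a \<Rightarrow> 'a \<Rightarrow> bool) W. finite W \<Longrightarrow> simple_graph E \<Longrightarrow> P6_free E W \<Longrightarrow>
      banner_free E W \<Longrightarrow> clique_free E w W \<Longrightarrow> game_decides E P q W" by blast
  obtain N where N: "\<And>(E :: 'a \<Rightarrow> 'a \<Rightarrow> bool) W ps. simple_graph E \<Longrightarrow> P6_free E W \<Longrightarrow> K23_free E W \<Longrightarrow>
      clique_free E (Suc w) W \<Longrightarrow> path_in E W ps \<Longrightarrow> length ps \<le> N"
    using bounded_path_length[of "Suc w"] by blast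
  \<comment> \<open>The depth is at most \<open>N\<close>, and a module takes at most
    \<open>Suc (card P)\<close> phases. A phase has \<open>Suc q\<close> rounds, enough for
    dominated modules by the induction hypothesis and for singleton classes, which need one
    round.\<close>
  let ?r = "N * (Suc (card P) * Suc q)"
  have "set_colorable E W Q"
    if W: "finite W" "simple_graph E" "P6_free E W" "banner_free E W" "clique_free E (Suc w) W"
      and Q: "Q \<subseteq> P" and win: "wins E W Q ?r {}" for E :: "'a \<Rightarrow> 'a \<Rightarrow> bool" and W Q
  proof -
    interpret banner_free_graph E W using W by unfold_locales
    let ?M = "class_of E W"
    note M_eq = class_of_eq[OF graph W(1)]
    have M_sub: "?M v \<subseteq> W" if "v \<in> W" for v
      using class_of_module[OF graph W(1) that] by (simp add: is_module_def)
    \<comment> \<open>The choice depends on the class as a set only, so vertices of one class share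
      their representative.\<close>
    define rep where "rep v = (SOME y. y \<in> ?M v)" for v
    have rep: "rep v \<in> ?M v" for v unfolding rep_def using class_of_self by (rule someI)
    then have M_rep: "?M (rep v) = ?M v" for v by (rule M_eq)
    let ?H = "rep ` W"
    have H: "?H \<subseteq> W" using rep M_sub by blast
    have inj: "x = y" if "x \<in> ?H" "y \<in> ?H" "?M x = ?M y" for x y
    proof -
      from that obtain u v where "x = rep u" "y = rep v" by blast
      with that(3) have "?M u = ?M v" using M_rep by simp
      then show ?thesis using \<open>x = rep u\<close> \<open>y = rep v\<close> by (simp add: rep_def)
    qed
    have adjacent: "E x' y'" if "x \<in> W" "y \<in> W" "?M x \<noteq> ?M y" "E x y" "x' \<in> ?M x" "y' \<in> ?M y" for x y x' y'
    proof -
      have "y \<notin> ?M x" "x' \<notin> ?M y" using M_eq that(3,5) by metis+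
      have "E y x'"
        using class_of_module[OF graph W(1) that(1)] that sym[OF that(4)] \<open>y \<notin> ?M x\<close> class_of_self[of x E W]
        unfolding is_module_def by blast
      then have "E x' y" by (rule sym)
      moreover have "x' \<in> W" using M_sub that by blast
      ultimately show ?thesis
        using class_of_module[OF graph W(1) that(2)] that \<open>x' \<notin> ?M y\<close> class_of_self[of y E W]
        unfolding is_module_def by blast
    qed
    have finQ: "finite Q" using assms Q finite_subset by blast
    have decides: "game_decides E Q (Suc q) (?M v)" if "v \<in> W" for v
      using class_of_cases[OF graph W(1), of v]
    proof
      assume "?M v = {v}"
      moreover have "game_decides E Q (Suc 0) {v}" using irrefl by (rule game_decides_singleton)
      ultimately show ?thesis by (metis game_decides_mono Suc_le_mono zero_le)
    next
      assume D: "dominated_module E W (?M v)"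
      then obtain a where a: "a \<in> W" "\<And>x. x \<in> ?M v \<Longrightarrow> E a x" unfolding dominated_module_def by blast
      have sub: "?M v \<subseteq> W" using M_sub that .
      have "game_decides E P q (?M v)"
        using finite_subset[OF sub W(1)] graph P6_free_subset[OF W(3) sub]
          banner_free_subset[OF W(4) sub] clique_free_dominated[OF W(5) sub a graph] by (rule q)
      then have "game_decides E P (Suc q) (?M v)" by (rule game_decides_mono) simp
      with Q show ?thesis unfolding game_decides_def by blast
    qed
    interpret module_transversal E W ?H ?M Q "Suc q"
    proof
      show "simple_graph E" by fact
      show "finite Q" by fact
      show "?M h \<subseteq> W" if "h \<in> ?H" for h using that H M_sub by blast
      show "game_decides E Q (Suc q) (?M h)" if "h \<in> ?H" for h using that H decides by blast
      show "E x y" if h: "h \<in> ?H" "h' \<in> ?H" "E h h'" "x \<in> ?M h" "y \<in> ?M h'" for h h' x y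
      proof (rule adjacent[OF _ _ _ h(3,4,5)])
        show "h \<in> W" "h' \<in> W" using h H by blast+
        show "?M h \<noteq> ?M h'" using inj[OF h(1,2)] h(3) irrefl by blast
      qed
    qed
    have "length vs \<le> N" if "path_in E ?H vs" for vs
      using graph P6_free_subset[OF W(3) H] transversal_K23_free[OF W(1) H inj]
        clique_free_subset[OF W(5) H] that by (rule N)
    moreover have "wins E W Q (N * (Suc (card Q) * Suc q)) {}"
      using win
      by (rule wins_mono_rounds) (intro mult_le_mono le_refl Suc_le_mono[THEN iffD2] card_mono[OF assms Q])
    ultimately obtain F where F: "palette_solution {} ?H F"
      using palette_solution_exists by blast
    then have "\<forall>h\<in>?H. \<exists>g. (\<forall>x\<in>?M h. g x \<in> F h) \<and> (\<forall>x\<in>?M h. \<forall>y\<in>?M h. E x y \<longrightarrow> g x \<noteq> g y)"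
      unfolding palette_solution_def set_colorable_def by blast
    from bchoice[OF this] obtain g where g: "\<And>h x. h \<in> ?H \<Longrightarrow> x \<in> ?M h \<Longrightarrow> g h x \<in> F h"
      "\<And>h x y. h \<in> ?H \<Longrightarrow> x \<in> ?M h \<Longrightarrow> y \<in> ?M h \<Longrightarrow> E x y \<Longrightarrow> g h x \<noteq> g h y" by blast
    let ?f = "\<lambda>x. g (rep x) x"
    have own: "x \<in> ?M (rep x)" for x using M_rep class_of_self by metis
    have "?f x \<in> Q" if "x \<in> W" for x
      using g(1)[of "rep x" x] own F that unfolding palette_solution_def by blast
    moreover have "?f x \<noteq> ?f y" if xy: "x \<in> W" "y \<in> W" "E x y" for x y
    proof (cases "?M x = ?M y")
      case True
      then have "rep x = rep y" by (simp add: rep_def)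
      with g(2)[of "rep x" x y] own[of x] own[of y] xy show ?thesis by simp
    next
      case False
      have "E (rep x) (rep y)" by (rule adjacent[OF xy(1,2) False xy(3) rep rep])
      then have "F (rep x) \<inter> F (rep y) = {}" using F xy unfolding palette_solution_def by blast
      moreover have "?f x \<in> F (rep x)" "?f y \<in> F (rep y)" using g(1) own xy by blast+
      ultimately show ?thesis by (metis disjoint_iff)
    qed
    ultimately show ?thesis unfolding set_colorable_def by (intro exI[of _ ?f]) blast
  qed
  then have "\<forall>(E :: 'a \<Rightarrow> 'a \<Rightarrow> bool) W. finite W \<and> simple_graph E \<and> P6_free E W \<and> banner_free E W \<and>
      clique_free E (Suc w) W \<longrightarrow> game_decides E P ?r W"
    unfolding game_decides_def by blast
  then show ?case by blast
qed

text \<open>When the spoiler picks the vertices of a clique one by one, the answers must be pairwise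
  distinct colors.\<close>

lemma wins_clique_free:
  assumes "finite P" "wins E W P (Suc (card P)) {}"
  shows "clique_free E (Suc (card P)) W"
  unfolding clique_free_def
proof (intro allI impI, rule ccontr)
  fix S assume S: "S \<subseteq> W" "finite S \<and> card S = Suc (card P)"
    and clique: "\<not> (\<exists>u\<in>S. \<exists>v\<in>S. u \<noteq> v \<and> \<not> E u v)"
  have "\<exists>f. (\<forall>v\<in>T. f v \<in> P) \<and> consistent E ((\<lambda>v. (v, f v)) ` T \<union> ps)"
    if "finite T" "T \<subseteq> W" "wins E W P (card T) ps" for T ps
    using that
  proof (induction arbitrary: ps rule: finite_induct)
    case empty
    then show ?case using wins_consistent by auto
  next
    case (insert v T)
    then obtain c where c: "c \<in> P" "wins E W P (card T) (insert (v, c) ps)" by auto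
    with insert obtain f where f: "\<forall>v\<in>T. f v \<in> P" "consistent E ((\<lambda>v. (v, f v)) ` T \<union> insert (v, c) ps)"
      by blast
    have "(\<lambda>u. (u, (f(v := c)) u)) ` insert v T \<union> ps = (\<lambda>v. (v, f v)) ` T \<union> insert (v, c) ps"
      using insert.hyps by auto
    with f c show ?case by (intro exI[of _ "f(v := c)"]) auto
  qed
  from this[of S "{}"] S assms(2) obtain f where
    f: "\<forall>v\<in>S. f v \<in> P" "consistent E ((\<lambda>v. (v, f v)) ` S)" by auto
  have "inj_on f S"
  proof (rule inj_onI, rule ccontr)
    fix u v assume "u \<in> S" "v \<in> S" "f u = f v" "u \<noteq> v"
    then show False using clique consistentD[OF f(2), of u "f u" v "f v"] by blast
  qed
  then have "card S \<le> card P" using f(1) assms(1) by (intro card_inj_on_le[of f]) auto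
  with S show False by simp
qed

theorem colorable_iff_wins:
  assumes "finite (P :: 'c set)"
  shows "\<exists>q. \<forall>(E :: 'a \<Rightarrow> 'a \<Rightarrow> bool) W. finite W \<and> simple_graph E \<and> P6_free E W \<and> banner_free E W \<longrightarrow>
      (set_colorable E W P \<longleftrightarrow> wins E W P q {})"
proof -
  obtain q where q: "\<And>(E :: 'a \<Rightarrow> 'a \<Rightarrow> bool) W. finite W \<and> simple_graph E \<and> P6_free E W \<and> banner_free E W \<and>
      clique_free E (Suc (card P)) W \<Longrightarrow> game_decides E P q W"
    using game_decides_clique_free[OF assms, of "Suc (card P)"] by blast
  \<comment> \<open>\<open>Suc (card P)\<close> rounds bound the clique number and \<open>q\<close>
    rounds then decide colorability; the sum exceeds both, and a win in it includes a win in
    each.\<close>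
  have "set_colorable E W P \<longleftrightarrow> wins E W P (q + Suc (card P)) {}"
    if W: "finite W \<and> simple_graph E \<and> P6_free E W \<and> banner_free E W" for E :: "'a \<Rightarrow> 'a \<Rightarrow> bool" and W
  proof
    assume "set_colorable E W P"
    then obtain f where "\<And>v. v \<in> W \<Longrightarrow> f v \<in> P" "\<And>u v. u \<in> W \<Longrightarrow> v \<in> W \<Longrightarrow> E u v \<Longrightarrow> f u \<noteq> f v"
      unfolding set_colorable_def by blast
    then show "wins E W P (q + Suc (card P)) {}" by (rule colorable_wins) simp_all
  next
    assume win: "wins E W P (q + Suc (card P)) {}"
    then have "wins E W P (Suc (card P)) {}" by (rule wins_mono_rounds) simp
    then have "game_decides E P q W" using q wins_clique_free[OF assms] W by blast
    moreover have "wins E W P q {}" using win by (rule wins_mono_rounds) simp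
    ultimately show "set_colorable E W P" unfolding game_decides_def by blast
  qed
  then show ?thesis by blast
qed

section \<open>Evaluating the game on the random access machine\<close>

text \<open>Total correctness with a time bound. An upper bound in place of the exact time lets
  branches of unequal length share one rule.\<close>

definition runs :: "program \<Rightarrow> machine_state \<Rightarrow> nat \<Rightarrow> (machine_state \<Rightarrow> bool) \<Rightarrow> bool" where
  "runs p s T Q \<longleftrightarrow> (\<exists>t s'. exec p s t s' \<and> t \<le> T \<and> Q s')"

lemma runsI: "exec p s t s' \<Longrightarrow> t \<le> T \<Longrightarrow> Q s' \<Longrightarrow> runs p s T Q"
  unfolding runs_def by blast

lemma runs_weaken: "runs p s T Q \<Longrightarrow> T \<le> T' \<Longrightarrow> (\<And>s'. Q s' \<Longrightarrow> Q' s') \<Longrightarrow> runs p s T' Q'"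
  unfolding runs_def by (meson le_trans)

lemma runs_Const: "Q (r(x := c), m) \<Longrightarrow> runs (Const x c) (r, m) 1 Q"
  unfolding runs_def using exec.Const by blast

lemma runs_Move: "Q (r(x := r y), m) \<Longrightarrow> runs (Move x y) (r, m) 1 Q"
  unfolding runs_def using exec.Move by blast

lemma runs_Add: "Q (r(x := r y + r z), m) \<Longrightarrow> runs (Add x y z) (r, m) 1 Q"
  unfolding runs_def using exec.Add by blast

lemma runs_Sub: "Q (r(x := r y - r z), m) \<Longrightarrow> runs (Sub x y z) (r, m) 1 Q"
  unfolding runs_def using exec.Sub by blast

lemma runs_Load: "Q (r(x := m (r y)), m) \<Longrightarrow> runs (Load x y) (r, m) 1 Q"
  unfolding runs_def using exec.Load by blast

lemma runs_Seq: "runs p s T (\<lambda>s'. runs q s' T' Q) \<Longrightarrow> runs (Seq p q) s (T + T') Q"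
  unfolding runs_def by (meson add_mono exec.Seq)

lemma runs_IfNZ:
  assumes "r x \<noteq> 0 \<Longrightarrow> runs p (r, m) T Q" "r x = 0 \<Longrightarrow> runs q (r, m) T Q"
  shows "runs (IfNZ x p q) (r, m) (Suc T) Q"
proof (cases "r x = 0")
  case True
  with assms(2) obtain t s' where "exec q (r, m) t s'" "t \<le> T" "Q s'" unfolding runs_def by blast
  with True show ?thesis by (intro runsI[OF exec.IfFalse]) auto
next
  case False
  with assms(1) obtain t s' where "exec p (r, m) t s'" "t \<le> T" "Q s'" unfolding runs_def by blast
  with False show ?thesis by (intro runsI[OF exec.IfTrue]) auto
qed

text \<open>The index of the invariant \<open>I\<close> is the number of iterations still to come.\<close>

lemma runs_WhileNZ:
  assumes "\<And>k r m. I (Suc k) (r, m) \<Longrightarrow> r x \<noteq> 0 \<and> runs p (r, m) T (I k)"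
    and "\<And>r m. I 0 (r, m) \<Longrightarrow> r x = 0"
  shows "I k s \<Longrightarrow> runs (WhileNZ x p) s (Suc (k * Suc T)) (I 0)"
proof (induction k arbitrary: s)
  case 0
  then have "fst s x = 0" using assms(2) by (cases s) auto
  with 0 show ?case by (intro runsI[OF exec.WhileFalse]) auto
next
  case (Suc k)
  then have x: "fst s x \<noteq> 0" and "runs p s T (I k)" using assms(1) by (cases s, auto)+
  then obtain t s' where p: "exec p s t s'" "t \<le> T" "I k s'" unfolding runs_def by blast
  obtain t' s'' where w: "exec (WhileNZ x p) s' t' s''" "t' \<le> Suc (k * Suc T)" "I 0 s''"
    using Suc.IH[OF p(3)] unfolding runs_def by blast
  have "Suc (t + t') \<le> Suc (Suc k * Suc T)" using p(2) w(2) by simp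
  with w(3) show ?case by (intro runsI[OF exec.WhileTrue[OF x p(1) w(1)]])
qed

abbreviation skip :: program where "skip \<equiv> Move 3 3"

text \<open>
  Register 1 holds the number \<open>n\<close> of vertices, register 2 the constant 1, registers 3 and 4
  temporaries, and register 6 the result. The pick of round \<open>i\<close> lives in four registers: the
  vertex \<open>v\<close>, its row offset \<open>n * v\<close>, a loop counter and the color; two more registers
  accumulate the values of the quantifiers over vertices and colors.
\<close>

abbreviation "vertex_reg i \<equiv> 10 + 6 * (i::nat)"
abbreviation "offset_reg i \<equiv> 11 + 6 * (i::nat)"
abbreviation "count_reg i \<equiv> 12 + 6 * (i::nat)"
abbreviation "color_reg i \<equiv> 13 + 6 * (i::nat)"
abbreviation "all_reg i \<equiv> 14 + 6 * (i::nat)"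
abbreviation "ex_reg i \<equiv> 15 + 6 * (i::nat)"

text \<open>Truncated differences in both directions add up to 0 exactly for equal colors. The
  address of the matrix entry is a row offset plus a column, so it needs no multiplication.\<close>

definition check_pair :: "nat \<Rightarrow> nat \<Rightarrow> program" where
  "check_pair a b =
     Seq (Add 3 (offset_reg a) (vertex_reg b)) (Seq (Load 3 3)
       (IfNZ 3
          (Seq (Sub 3 (color_reg a) (color_reg b)) (Seq (Sub 4 (color_reg b) (color_reg a))
            (Seq (Add 3 3 4) (IfNZ 3 skip (Const 6 0)))))
          skip))"

primrec check_pairs :: "(nat \<times> nat) list \<Rightarrow> program" where
  "check_pairs [] = Const 6 1"
| "check_pairs (ab # rest) = Seq (check_pairs rest) (check_pair (fst ab) (snd ab))"

text \<open>Colors and rounds are constant in number and are unrolled into the program text; only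
  the loops over the vertices remain for run time.\<close>

primrec try_colors :: "nat \<Rightarrow> program \<Rightarrow> nat list \<Rightarrow> program" where
  "try_colors i p [] = Const (ex_reg i) 0"
| "try_colors i p (c # cs) =
     Seq (try_colors i p cs) (Seq (Const (color_reg i) c)
       (Seq p (IfNZ 6 (Const (ex_reg i) 1) skip)))"

definition all_pairs :: "nat \<Rightarrow> (nat \<times> nat) list" where
  "all_pairs i = List.product [0..<i] [0..<i]"

primrec play :: "nat list \<Rightarrow> nat \<Rightarrow> nat \<Rightarrow> program" where
  "play cs 0 i = check_pairs (all_pairs i)"
| "play cs (Suc q) i =
     Seq (check_pairs (all_pairs i)) (Seq (Move (all_reg i) 6) (Seq (Const (vertex_reg i) 0)
       (Seq (Const (offset_reg i) 0) (Seq (Move (count_reg i) 1)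
       (Seq
         (WhileNZ (count_reg i)
           (Seq (try_colors i (play cs q (Suc i)) cs)
           (Seq (IfNZ (ex_reg i) skip (Const (all_reg i) 0))
           (Seq (Add (vertex_reg i) (vertex_reg i) 2) (Seq (Add (offset_reg i) (offset_reg i) 1)
             (Sub (count_reg i) (count_reg i) 2))))))
         (Move 6 (all_reg i)))))))"

definition check_time :: "nat \<Rightarrow> nat" where
  "check_time i = 1 + i * i * 8"

text \<open>Per color, 3 pays for the assignment and the conditional. Per vertex, 7 pays for the
  loop test, the reset of \<open>ex_reg\<close>, the conditional (2) and the three updates. The 6
  covers four initial assignments, the last loop test and the final move.\<close>

primrec play_time :: "nat \<Rightarrow> nat \<Rightarrow> nat \<Rightarrow> nat poly" where
  "play_time k 0 i = [:check_time i:]"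
| "play_time k (Suc q) i =
     [:check_time i + 6:] + [:0, 1:] * ([:7:] + smult k ([:3:] + play_time k q (Suc i)))"

definition picks :: "(nat \<Rightarrow> nat) \<Rightarrow> nat \<Rightarrow> (nat \<times> nat) set" where
  "picks r i = (\<lambda>a. (r (vertex_reg a), r (color_reg a))) ` {..<i}"

text \<open>Evaluating the game from round \<open>i\<close> on may overwrite temporaries and the
  registers of round \<open>i\<close> and later; what the enclosing loops rely on is
  protected.\<close>

definition frame :: "nat \<Rightarrow> (nat \<Rightarrow> nat) \<Rightarrow> (nat \<Rightarrow> nat) \<Rightarrow> bool" where
  "frame i r r' \<longleftrightarrow> r' 1 = r 1 \<and> r' 2 = r 2 \<and> (\<forall>x. 10 \<le> x \<and> x < 10 + 6 * i \<longrightarrow> r' x = r x)"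

lemma picks_frame: "frame i r r' \<Longrightarrow> picks r' i = picks r i"
  unfolding picks_def frame_def by (intro image_cong) auto

lemma picks_Suc: "picks r (Suc i) = insert (r (vertex_reg i), r (color_reg i)) (picks r i)"
  unfolding picks_def by (simp add: lessThan_Suc)

section \<open>Correctness of the evaluation\<close>

locale matrix_memory =
  fixes n :: nat and mem :: "nat \<Rightarrow> nat" and E :: "nat \<Rightarrow> nat \<Rightarrow> bool"
  assumes adjacency: "u < n \<Longrightarrow> v < n \<Longrightarrow> mem (u * n + v) \<noteq> 0 \<longleftrightarrow> E u v"
begin

definition ready :: "nat \<Rightarrow> (nat \<Rightarrow> nat) \<Rightarrow> bool" where
  "ready i r \<longleftrightarrow> r 1 = n \<and> r 2 = 1 \<and>
     (\<forall>a<i. r (vertex_reg a) < n \<and> r (offset_reg a) = r (vertex_reg a) * n)"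

lemma ready_frame: "frame i r r' \<Longrightarrow> ready i r \<Longrightarrow> ready i r'"
  unfolding ready_def frame_def by auto

lemma runs_check_pair:
  assumes "ready i r" "a < i" "b < i"
  shows "runs (check_pair a b) (r, mem) 8 (\<lambda>(r', m'). m' = mem \<and> (\<forall>x. x \<notin> {3, 4, 6} \<longrightarrow> r' x = r x) \<and>
    r' 6 = (if E (r (vertex_reg a)) (r (vertex_reg b)) \<and> r (color_reg a) = r (color_reg b) then 0 else r 6))"
proof -
  let ?Q = "\<lambda>(r', m'). m' = mem \<and> (\<forall>x. x \<notin> {3, 4, 6} \<longrightarrow> r' x = r x) \<and>
    r' 6 = (if E (r (vertex_reg a)) (r (vertex_reg b)) \<and> r (color_reg a) = r (color_reg b) then 0 else r 6)"
  have addr: "r (offset_reg a) + r (vertex_reg b) = r (vertex_reg a) * n + r (vertex_reg b)"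
    and adj: "mem (r (vertex_reg a) * n + r (vertex_reg b)) \<noteq> 0 \<longleftrightarrow> E (r (vertex_reg a)) (r (vertex_reg b))"
    using assms adjacency unfolding ready_def by auto
  let ?cu = "r (color_reg a)" and ?cw = "r (color_reg b)"
  let ?r1 = "r(3 := mem (r (vertex_reg a) * n + r (vertex_reg b)))"
  have test: "runs (IfNZ 3 (Seq (Sub 3 (color_reg a) (color_reg b)) (Seq (Sub 4 (color_reg b) (color_reg a))
      (Seq (Add 3 3 4) (IfNZ 3 skip (Const 6 0))))) skip) (?r1, mem) (Suc 5) ?Q"
  proof (rule runs_IfNZ)
    assume "?r1 3 \<noteq> 0"
    then have e: "E (r (vertex_reg a)) (r (vertex_reg b))" using adj by simp
    let ?r2 = "?r1(3 := ?cu - ?cw, 4 := ?cw - ?cu, 3 := ?cu - ?cw + (?cw - ?cu))"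
    have "runs (IfNZ 3 skip (Const 6 0)) (?r2, mem) (Suc 1) ?Q"
    proof (rule runs_IfNZ)
      assume "?r2 3 \<noteq> 0"
      then have "?cu \<noteq> ?cw" by auto
      then show "runs skip (?r2, mem) 1 ?Q" by (intro runs_Move) simp
    next
      assume "?r2 3 = 0"
      then have "?cu = ?cw" by simp
      with e show "runs (Const 6 0) (?r2, mem) 1 ?Q" by (intro runs_Const) simp
    qed
    then have "runs (Seq (Sub 3 (color_reg a) (color_reg b)) (Seq (Sub 4 (color_reg b) (color_reg a))
      (Seq (Add 3 3 4) (IfNZ 3 skip (Const 6 0))))) (?r1, mem) (1 + (1 + (1 + Suc 1))) ?Q"
      by (intro runs_Seq runs_Sub runs_Add) (simp split del: if_split)
    then show "runs (Seq (Sub 3 (color_reg a) (color_reg b)) (Seq (Sub 4 (color_reg b) (color_reg a))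
      (Seq (Add 3 3 4) (IfNZ 3 skip (Const 6 0))))) (?r1, mem) 5 ?Q"
      by (rule runs_weaken) simp_all
  next
    assume "?r1 3 = 0"
    then have "\<not> E (r (vertex_reg a)) (r (vertex_reg b))" using adj by simp
    then have "runs skip (?r1, mem) 1 ?Q" by (intro runs_Move) simp
    then show "runs skip (?r1, mem) 5 ?Q" by (rule runs_weaken) simp_all
  qed
  have "runs (check_pair a b) (r, mem) (1 + (1 + Suc 5)) ?Q"
    unfolding check_pair_def
    by (intro runs_Seq runs_Add runs_Load) (use test addr in \<open>simp split del: if_split\<close>)
  then show ?thesis by (rule runs_weaken) simp_all
qed

lemma runs_check_pairs:
  assumes "ready i r" "set rest \<subseteq> {..<i} \<times> {..<i}"
  shows "runs (check_pairs rest) (r, mem) (1 + length rest * 8) (\<lambda>(r', m'). m' = mem \<and>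
    (\<forall>x. x \<notin> {3, 4, 6} \<longrightarrow> r' x = r x) \<and>
    r' 6 = of_bool (\<forall>(a, b)\<in>set rest. E (r (vertex_reg a)) (r (vertex_reg b)) \<longrightarrow> r (color_reg a) \<noteq> r (color_reg b)))"
  using assms(2)
proof (induction rest)
  case Nil
  show ?case unfolding check_pairs.simps list.size mult_0 add_0_right by (rule runs_Const) simp
next
  case (Cons ab rest)
  obtain a b where ab: "ab = (a, b)" "a < i" "b < i" using Cons.prems by auto
  let ?ok = "\<lambda>(a, b). E (r (vertex_reg a)) (r (vertex_reg b)) \<longrightarrow> r (color_reg a) \<noteq> r (color_reg b)"
  have "runs (check_pairs (ab # rest)) (r, mem) ((1 + length rest * 8) + 8) (\<lambda>(r', m'). m' = mem \<and>
    (\<forall>x. x \<notin> {3, 4, 6} \<longrightarrow> r' x = r x) \<and> r' 6 = of_bool (\<forall>ab\<in>set (ab # rest). ?ok ab))"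
    unfolding check_pairs.simps
  proof (rule runs_Seq, rule runs_weaken[OF Cons.IH])
    show "set rest \<subseteq> {..<i} \<times> {..<i}" using Cons.prems by simp
  next
    fix s :: machine_state
    assume s: "case s of (r', m') \<Rightarrow> m' = mem \<and> (\<forall>x. x \<notin> {3, 4, 6} \<longrightarrow> r' x = r x) \<and>
      r' 6 = of_bool (\<forall>ab\<in>set rest. ?ok ab)"
    obtain r1 where r1: "s = (r1, mem)" "\<And>x. x \<notin> {3, 4, 6} \<Longrightarrow> r1 x = r x"
      "r1 6 = of_bool (\<forall>ab\<in>set rest. ?ok ab)"
      using s by (cases s) auto
    have "ready i r1" using assms(1) r1(2) unfolding ready_def by auto
    from runs_check_pair[OF this ab(2,3)]
    show "runs (check_pair (fst ab) (snd ab)) s 8 (\<lambda>(r', m'). m' = mem \<and>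
        (\<forall>x. x \<notin> {3, 4, 6} \<longrightarrow> r' x = r x) \<and> r' 6 = of_bool (\<forall>ab\<in>set (ab # rest). ?ok ab))"
      unfolding ab(1) r1(1) fst_conv snd_conv
    proof (rule runs_weaken, simp)
      fix s' :: machine_state
      assume s': "case s' of (r', m') \<Rightarrow> m' = mem \<and> (\<forall>x. x \<notin> {3, 4, 6} \<longrightarrow> r' x = r1 x) \<and>
        r' 6 = (if E (r1 (vertex_reg a)) (r1 (vertex_reg b)) \<and> r1 (color_reg a) = r1 (color_reg b)
          then 0 else r1 6)"
      then show "case s' of (r', m') \<Rightarrow> m' = mem \<and> (\<forall>x. x \<notin> {3, 4, 6} \<longrightarrow> r' x = r x) \<and>
        r' 6 = of_bool (\<forall>ab\<in>set ((a, b) # rest). ?ok ab)"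
        using r1(2,3) by (cases s') auto
    qed
  qed simp
  then show ?case by (rule runs_weaken) simp_all
qed

lemma runs_check:
  assumes "ready i r"
  shows "runs (check_pairs (all_pairs i)) (r, mem) (check_time i) (\<lambda>(r', m'). m' = mem \<and>
    (\<forall>x. x \<notin> {3, 4, 6} \<longrightarrow> r' x = r x) \<and> r' 6 = of_bool (consistent E (picks r i)))"
proof -
  have set: "set (all_pairs i) = {..<i} \<times> {..<i}" and len: "length (all_pairs i) = i * i"
    by (auto simp: all_pairs_def)
  have "consistent E (picks r i) \<longleftrightarrow> (\<forall>(a, b)\<in>set (all_pairs i).
      E (r (vertex_reg a)) (r (vertex_reg b)) \<longrightarrow> r (color_reg a) \<noteq> r (color_reg b))"
    unfolding set consistent_def picks_def by auto
  with runs_check_pairs[OF assms, of "all_pairs i"] show ?thesis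
    unfolding check_time_def len set by simp
qed

lemma runs_try_colors:
  assumes r: "ready i r" "r (vertex_reg i) < n" "r (offset_reg i) = r (vertex_reg i) * n"
    and p: "\<And>r'. ready (Suc i) r' \<Longrightarrow> runs p (r', mem) T (\<lambda>(r'', m'). m' = mem \<and> frame (Suc i) r' r'' \<and>
        r'' 6 = of_bool (R (picks r' (Suc i))))"
  shows "runs (try_colors i p cs) (r, mem) (1 + length cs * (3 + T)) (\<lambda>(r', m'). m' = mem \<and> frame i r r' \<and>
    (\<forall>x\<in>{vertex_reg i, offset_reg i, count_reg i, all_reg i}. r' x = r x) \<and>
    r' (ex_reg i) = of_bool (\<exists>c\<in>set cs. R (insert (r (vertex_reg i), c) (picks r i))))"
proof (induction cs)
  case Nil
  show ?case unfolding try_colors.simps list.size mult_0 add_0_right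
    by (rule runs_Const) (auto simp: frame_def)
next
  case (Cons c cs)
  let ?keep = "\<lambda>r'. \<forall>x\<in>{vertex_reg i, offset_reg i, count_reg i, all_reg i}. r' x = r x"
  let ?R = "\<lambda>c. R (insert (r (vertex_reg i), c) (picks r i))"
  let ?Q = "\<lambda>cs (r', m'). m' = mem \<and> frame i r r' \<and> ?keep r' \<and> r' (ex_reg i) = of_bool (\<exists>c\<in>set cs. ?R c)"
  have "runs (try_colors i p (c # cs)) (r, mem) ((1 + length cs * (3 + T)) + (1 + (T + Suc 1))) (?Q (c # cs))"
    unfolding try_colors.simps
  proof (rule runs_Seq, rule runs_weaken[OF Cons.IH order_refl])
    fix s assume s: "?Q cs s"
    then obtain r1 where r1: "s = (r1, mem)" "frame i r r1" "?keep r1"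
      "r1 (ex_reg i) = of_bool (\<exists>c\<in>set cs. ?R c)"
      by (cases s) auto
    let ?r2 = "r1(color_reg i := c)"
    have "ready i r1" using ready_frame r1(2) r(1) by blast
    then have ready: "ready (Suc i) ?r2"
      using r(2,3) r1(3) unfolding ready_def less_Suc_eq by auto
    have "frame i r ?r2" using r1(2) unfolding frame_def by auto
    then have picks: "picks ?r2 (Suc i) = insert (r (vertex_reg i), c) (picks r i)"
      using r1(3) by (simp add: picks_Suc picks_frame)
    show "runs (Seq (Const (color_reg i) c) (Seq p (IfNZ 6 (Const (ex_reg i) 1) skip))) s
      (1 + (T + Suc 1)) (?Q (c # cs))"
      unfolding r1(1)
    proof (rule runs_Seq, rule runs_Const, rule runs_Seq, rule runs_weaken[OF p[OF ready] order_refl])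
      fix s' :: machine_state
      assume s': "case s' of (r'', m') \<Rightarrow> m' = mem \<and> frame (Suc i) ?r2 r'' \<and>
        r'' 6 = of_bool (R (picks ?r2 (Suc i)))"
      then obtain r3 where r3: "s' = (r3, mem)" "frame (Suc i) ?r2 r3" "r3 6 = of_bool (?R c)"
        unfolding picks by (cases s') auto
      have low: "\<And>x. 10 \<le> x \<Longrightarrow> x < 16 + 6 * i \<Longrightarrow> r3 x = ?r2 x"
        using r3(2) unfolding frame_def by auto
      have fr: "frame i r r3"
        using r3(2) r1(2) unfolding frame_def by auto
      have keep: "?keep r3" using low r1(3) by auto
      have ex: "r3 (ex_reg i) = of_bool (\<exists>c\<in>set cs. ?R c)" using low r1(4) by auto
      show "runs (IfNZ 6 (Const (ex_reg i) 1) skip) s' (Suc 1) (?Q (c # cs))"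
        unfolding r3(1)
      proof (rule runs_IfNZ)
        assume "r3 6 \<noteq> 0"
        then show "runs (Const (ex_reg i) 1) (r3, mem) 1 (?Q (c # cs))"
          using r3(3) fr keep by (intro runs_Const) (auto simp: frame_def)
      next
        assume "r3 6 = 0"
        then show "runs skip (r3, mem) 1 (?Q (c # cs))"
          using r3(3) fr keep ex by (intro runs_Move) auto
      qed
    qed
  qed
  then show ?case by (rule runs_weaken) auto
qed

lemma runs_play:
  assumes "ready i r"
  shows "runs (play cs q i) (r, mem) (poly (play_time (length cs) q i) n) (\<lambda>(r', m'). m' = mem \<and>
    frame i r r' \<and> r' 6 = of_bool (wins E {..<n} (set cs) q (picks r i)))"
  using assms
proof (induction q arbitrary: i r)
  case 0
  show ?case
    unfolding play.simps
  proof (rule runs_weaken[OF runs_check[OF 0]])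
    fix s' :: machine_state
    assume "case s' of (r', m') \<Rightarrow> m' = mem \<and> (\<forall>x. x \<notin> {3, 4, 6} \<longrightarrow> r' x = r x) \<and>
      r' 6 = of_bool (consistent E (picks r i))"
    then show "case s' of (r', m') \<Rightarrow> m' = mem \<and> frame i r r' \<and>
      r' 6 = of_bool (wins E {..<n} (set cs) 0 (picks r i))"
      by (cases s') (auto simp: frame_def)
  qed simp
next
  case (Suc q)
  let ?ps = "picks r i"
  let ?T = "poly (play_time (length cs) q (Suc i)) n"
  let ?good = "\<lambda>v. \<exists>c\<in>set cs. wins E {..<n} (set cs) q (insert (v, c) ?ps)"
  \<comment> \<open>With \<open>k\<close> iterations to come, the vertices below
    \<open>n - k\<close> are done. The row offset follows the vertex by repeated addition of
    \<open>n\<close>.\<close>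
  let ?I = "\<lambda>k (r', m'). m' = mem \<and> frame i r r' \<and> k \<le> n \<and> r' (count_reg i) = k \<and>
    r' (vertex_reg i) = n - k \<and> r' (offset_reg i) = (n - k) * n \<and>
    r' (all_reg i) = of_bool (consistent E ?ps \<and> (\<forall>v<n - k. ?good v))"
  let ?body = "Seq (try_colors i (play cs q (Suc i)) cs)
           (Seq (IfNZ (ex_reg i) skip (Const (all_reg i) 0))
           (Seq (Add (vertex_reg i) (vertex_reg i) 2) (Seq (Add (offset_reg i) (offset_reg i) 1)
             (Sub (count_reg i) (count_reg i) 2))))"
  let ?B = "(1 + length cs * (3 + ?T)) + (Suc 1 + (1 + (1 + 1)))"
  have body: "r1 (count_reg i) \<noteq> 0 \<and> runs ?body (r1, m1) ?B (?I k)" if I: "?I (Suc k) (r1, m1)" for k r1 m1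
  proof
    show "r1 (count_reg i) \<noteq> 0" using I by simp
    have m1: "m1 = mem" and fr: "frame i r r1" and k: "Suc k \<le> n" and cnt: "r1 (count_reg i) = Suc k"
      and v: "r1 (vertex_reg i) = n - Suc k" and off: "r1 (offset_reg i) = (n - Suc k) * n"
      and all: "r1 (all_reg i) = of_bool (consistent E ?ps \<and> (\<forall>v<n - Suc k. ?good v))"
      using I by auto
    have ready: "ready i r1" using ready_frame fr Suc.prems by blast
    have picks: "picks r1 i = ?ps" by (rule picks_frame[OF fr])
    have nk: "n - k = Suc (n - Suc k)" using k by simp
    have "runs ?body (r1, mem) ?B (?I k)"
    proof (rule runs_Seq, rule runs_weaken[OF runs_try_colors[OF ready _ _ Suc.IH] order_refl])
      show "r1 (vertex_reg i) < n" using v k by simp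
      show "r1 (offset_reg i) = r1 (vertex_reg i) * n" using v off by simp
      fix s :: machine_state
      assume "case s of (r', m') \<Rightarrow> m' = mem \<and> frame i r1 r' \<and>
        (\<forall>x\<in>{vertex_reg i, offset_reg i, count_reg i, all_reg i}. r' x = r1 x) \<and>
        r' (ex_reg i) = of_bool (\<exists>c\<in>set cs. wins E {..<n} (set cs) q (insert (r1 (vertex_reg i), c) (picks r1 i)))"
      then obtain r2 where s: "s = (r2, mem)" and fr2: "frame i r1 r2"
        and keep: "r2 (vertex_reg i) = n - Suc k" "r2 (offset_reg i) = (n - Suc k) * n"
          "r2 (count_reg i) = Suc k" "r2 (all_reg i) = of_bool (consistent E ?ps \<and> (\<forall>v<n - Suc k. ?good v))"
        and ex: "r2 (ex_reg i) = of_bool (?good (n - Suc k))"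
        using v off cnt all unfolding picks by (cases s) auto
      have fr': "frame i r r2" using fr fr2 unfolding frame_def by auto
      have all': "of_bool (consistent E ?ps \<and> (\<forall>v<n - k. ?good v)) =
          (if ?good (n - Suc k) then r2 (all_reg i) else 0)"
        unfolding keep nk by (auto simp: less_Suc_eq)
      let ?Q = "\<lambda>(r', m'). m' = mem \<and> frame i r r' \<and> r' (vertex_reg i) = n - Suc k \<and>
        r' (offset_reg i) = (n - Suc k) * n \<and> r' (count_reg i) = Suc k \<and>
        r' (all_reg i) = of_bool (consistent E ?ps \<and> (\<forall>v<n - k. ?good v))"
      show "runs (Seq (IfNZ (ex_reg i) skip (Const (all_reg i) 0))
           (Seq (Add (vertex_reg i) (vertex_reg i) 2) (Seq (Add (offset_reg i) (offset_reg i) 1)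
             (Sub (count_reg i) (count_reg i) 2)))) s (Suc 1 + (1 + (1 + 1))) (?I k)"
      proof (rule runs_Seq, rule runs_weaken[where Q = ?Q, OF _ order_refl])
        show "runs (IfNZ (ex_reg i) skip (Const (all_reg i) 0)) s (Suc 1) ?Q"
          unfolding s all'
        proof (rule runs_IfNZ)
          assume "r2 (ex_reg i) \<noteq> 0"
          then have "?good (n - Suc k)" using ex by simp
          then show "runs skip (r2, mem) 1 (\<lambda>(r', m'). m' = mem \<and> frame i r r' \<and> r' (vertex_reg i) = n - Suc k \<and>
            r' (offset_reg i) = (n - Suc k) * n \<and> r' (count_reg i) = Suc k \<and>
            r' (all_reg i) = (if ?good (n - Suc k) then r2 (all_reg i) else 0))"
            using fr' keep by (intro runs_Move) simp
        next
          assume "r2 (ex_reg i) = 0"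
          then have n: "\<not> ?good (n - Suc k)" using ex by simp
          have "frame i r (r2(all_reg i := 0))" using fr' unfolding frame_def by auto
          with n show "runs (Const (all_reg i) 0) (r2, mem) 1 (\<lambda>(r', m'). m' = mem \<and> frame i r r' \<and> r' (vertex_reg i) = n - Suc k \<and>
            r' (offset_reg i) = (n - Suc k) * n \<and> r' (count_reg i) = Suc k \<and>
            r' (all_reg i) = (if ?good (n - Suc k) then r2 (all_reg i) else 0))"
            using keep by (intro runs_Const) simp
        qed
      next
        fix s' assume "?Q s'"
        then obtain r3 where s': "s' = (r3, mem)" and fr3: "frame i r r3"
          and keep3: "r3 (vertex_reg i) = n - Suc k" "r3 (offset_reg i) = (n - Suc k) * n"
            "r3 (count_reg i) = Suc k"
            "r3 (all_reg i) = of_bool (consistent E ?ps \<and> (\<forall>v<n - k. ?good v))"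
          by (cases s') auto
        have "r 1 = n" "r 2 = 1" using Suc.prems unfolding ready_def by auto
        then have one: "r3 1 = n" "r3 2 = 1" using fr3 unfolding frame_def by auto
        let ?r4 = "r3(vertex_reg i := n - k, offset_reg i := (n - k) * n, count_reg i := k)"
        have fr4: "frame i r ?r4" using fr3 unfolding frame_def by auto
        show "runs (Seq (Add (vertex_reg i) (vertex_reg i) 2) (Seq (Add (offset_reg i) (offset_reg i) 1)
             (Sub (count_reg i) (count_reg i) 2))) s' (1 + (1 + 1)) (?I k)"
          unfolding s'
        proof (rule runs_Seq, rule runs_Add, rule runs_Seq, rule runs_Add, rule runs_Sub)
          have "r3(vertex_reg i := r3 (vertex_reg i) + r3 2,
              offset_reg i := (r3(vertex_reg i := r3 (vertex_reg i) + r3 2)) (offset_reg i) +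
                (r3(vertex_reg i := r3 (vertex_reg i) + r3 2)) 1,
              count_reg i := (r3(vertex_reg i := r3 (vertex_reg i) + r3 2,
                offset_reg i := (r3(vertex_reg i := r3 (vertex_reg i) + r3 2)) (offset_reg i) +
                (r3(vertex_reg i := r3 (vertex_reg i) + r3 2)) 1)) (count_reg i) -
                (r3(vertex_reg i := r3 (vertex_reg i) + r3 2,
                offset_reg i := (r3(vertex_reg i := r3 (vertex_reg i) + r3 2)) (offset_reg i) +
                (r3(vertex_reg i := r3 (vertex_reg i) + r3 2)) 1)) 2) = ?r4" (is "?l = _")
            using keep3 one by (simp add: nk add.commute)
          moreover have "?I k (?r4, mem)" using fr4 keep3(4) k by simp
          ultimately show "?I k (?l, mem)" by simp
        qed
      qed
    qed
    then show "runs ?body (r1, m1) ?B (?I k)" unfolding m1 .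
  qed
  have loop: "?I n s \<Longrightarrow> runs (WhileNZ (count_reg i) ?body) s (Suc (n * Suc ?B)) (?I 0)" for s
  proof (rule runs_WhileNZ[of ?I])
    show "?I (Suc k) (r, m) \<Longrightarrow> r (count_reg i) \<noteq> 0 \<and> runs ?body (r, m) ?B (?I k)" for k r m
      by (rule body)
  qed auto
  have "runs (play cs (Suc q) i) (r, mem)
      (check_time i + (1 + (1 + (1 + (1 + (Suc (n * Suc ?B) + 1))))))
      (\<lambda>(r', m'). m' = mem \<and> frame i r r' \<and> r' 6 = of_bool (wins E {..<n} (set cs) (Suc q) ?ps))"
    unfolding play.simps
  proof (rule runs_Seq, rule runs_weaken[OF runs_check[OF Suc.prems] order_refl])
    fix s :: machine_state
    assume "case s of (r', m') \<Rightarrow> m' = mem \<and> (\<forall>x. x \<notin> {3, 4, 6} \<longrightarrow> r' x = r x) \<and>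
      r' 6 = of_bool (consistent E ?ps)"
    then obtain r1 where s: "s = (r1, mem)" and fr: "frame i r r1" and res: "r1 6 = of_bool (consistent E ?ps)"
      by (cases s) (auto simp: frame_def)
    have one: "r1 1 = n" using fr Suc.prems unfolding ready_def frame_def by auto
    show "runs (Seq (Move (all_reg i) 6) (Seq (Const (vertex_reg i) 0) (Seq (Const (offset_reg i) 0)
        (Seq (Move (count_reg i) 1) (Seq (WhileNZ (count_reg i) ?body) (Move 6 (all_reg i))))))) s
        (1 + (1 + (1 + (1 + (Suc (n * Suc ?B) + 1)))))
      (\<lambda>(r', m'). m' = mem \<and> frame i r r' \<and> r' 6 = of_bool (wins E {..<n} (set cs) (Suc q) ?ps))"
      unfolding s
    proof (rule runs_Seq, rule runs_Move, rule runs_Seq, rule runs_Const, rule runs_Seq, rule runs_Const,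
        rule runs_Seq, rule runs_Move, rule runs_Seq, rule runs_weaken[OF loop order_refl], goal_cases)
      case 1
      then show ?case using fr one res by (auto simp: frame_def)
    next
      case (2 s')
      then obtain r2 where s': "s' = (r2, mem)" and fr2: "frame i r r2"
        and res2: "r2 (all_reg i) = of_bool (consistent E ?ps \<and> (\<forall>v<n. ?good v))"
        by (cases s') auto
      have "frame i r (r2(6 := r2 (all_reg i)))" using fr2 unfolding frame_def by auto
      then show ?case unfolding s' using res2 by (intro runs_Move) (simp add: Ball_def)
    qed
  qed
  then show ?case by (rule runs_weaken) (simp_all add: algebra_simps)
qed

end

text \<open>The square root of the word length \<open>n * n\<close> by summing odd numbers: register
  3 holds \<open>j * j\<close> for the value \<open>j\<close> of register 1, and adding
  \<open>j\<close> twice and then 1 gives the next square. Register 4 is the gap left to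
  \<open>n * n\<close>.\<close>

definition read_size :: program where
  "read_size =
     Seq (Const 2 1) (Seq (Sub 4 0 3)
       (WhileNZ 4 (Seq (Add 3 3 1) (Seq (Add 3 3 1) (Seq (Add 3 3 2) (Seq (Add 1 1 2) (Sub 4 0 3)))))))"

lemma runs_read_size:
  assumes "r 0 = n * n" "r 1 = 0" "r 3 = 0"
  shows "runs read_size (r, m) (3 + n * 6) (\<lambda>(r', m'). m' = m \<and> r' 1 = n \<and> r' 2 = 1)"
proof -
  let ?I = "\<lambda>k (r', m'). m' = m \<and> r' 0 = n * n \<and> r' 2 = 1 \<and> k \<le> n \<and> r' 1 = n - k \<and>
    r' 3 = (n - k) * (n - k) \<and> r' 4 = n * n - (n - k) * (n - k)"
  let ?body = "Seq (Add 3 3 1) (Seq (Add 3 3 1) (Seq (Add 3 3 2) (Seq (Add 1 1 2) (Sub 4 0 3))))"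
  have body: "r1 4 \<noteq> 0 \<and> runs ?body (r1, m1) (1 + (1 + (1 + (1 + 1)))) (?I k)"
    if I: "?I (Suc k) (r1, m1)" for k r1 m1
  proof
    define j where "j = n - Suc k"
    have j: "j < n" "n - k = Suc j" using I by (auto simp: j_def)
    have r1: "m1 = m" "r1 0 = n * n" "r1 2 = 1" "k \<le> n" "r1 1 = j" "r1 3 = j * j" "r1 4 = n * n - j * j"
      using I by (auto simp: j_def)
    have "j * j < n * n" using j(1) by (intro mult_strict_mono) auto
    then show "r1 4 \<noteq> 0" using r1 by simp
    show "runs ?body (r1, m1) (1 + (1 + (1 + (1 + 1)))) (?I k)"
      by (intro runs_Seq runs_Add runs_Sub) (use r1 in \<open>simp add: j(2)\<close>)
  qed
  have "runs read_size (r, m) (1 + (1 + Suc (n * Suc (1 + (1 + (1 + (1 + 1))))))) (?I 0)"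
    unfolding read_size_def
  proof (rule runs_Seq, rule runs_Const, rule runs_Seq, rule runs_Sub, rule runs_WhileNZ[of ?I])
    show "?I (Suc k) (r, m) \<Longrightarrow> r 4 \<noteq> 0 \<and> runs ?body (r, m) (1 + (1 + (1 + (1 + 1)))) (?I k)" for k r m
      by (rule body)
  qed (use assms in auto)
  then show ?thesis by (rule runs_weaken) auto
qed

definition decide_coloring :: "nat list \<Rightarrow> nat \<Rightarrow> program" where
  "decide_coloring cs q = Seq read_size (Seq (play cs q 0) (Move 0 6))"

lemma decide_coloring_correct:
  assumes "length w = n * n" and "\<And>u v. u < n \<Longrightarrow> v < n \<Longrightarrow> w ! (u * n + v) \<longleftrightarrow> E u v"
  shows "runs (decide_coloring cs q) (initial_state w) (3 + n * 6 + (poly (play_time (length cs) q 0) n + 1))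
    (\<lambda>s. accepting s \<longleftrightarrow> wins E {..<n} (set cs) q {})"
proof -
  let ?mem = "\<lambda>i. if i < length w then of_bool (w ! i) else 0 :: nat"
  have "u * n + v < n * n" if "u < n" "v < n" for u v
  proof -
    have "u * n + v < Suc u * n" using that by simp
    also have "\<dots> \<le> n * n" using that by (intro mult_le_mono1) simp
    finally show ?thesis .
  qed
  then interpret matrix_memory n ?mem E
    using assms by unfold_locales auto
  show ?thesis
    unfolding decide_coloring_def initial_state_def
  proof (rule runs_Seq, rule runs_weaken[OF runs_read_size order_refl])
    fix s :: machine_state
    assume "case s of (r', m') \<Rightarrow> m' = ?mem \<and> r' 1 = n \<and> r' 2 = 1"
    then obtain r where s: "s = (r, ?mem)" and r: "ready 0 r" by (cases s) (auto simp: ready_def)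
    show "runs (Seq (play cs q 0) (Move 0 6)) s (poly (play_time (length cs) q 0) n + 1)
      (\<lambda>s. accepting s \<longleftrightarrow> wins E {..<n} (set cs) q {})"
      unfolding s
    proof (rule runs_Seq, rule runs_weaken[OF runs_play[OF r] order_refl])
      fix s' :: machine_state
      assume "case s' of (r', m') \<Rightarrow> m' = ?mem \<and> frame 0 r r' \<and> r' 6 = of_bool (wins E {..<n} (set cs) q (picks r 0))"
      then show "runs (Move 0 6) s' 1 (\<lambda>s. accepting s \<longleftrightarrow> wins E {..<n} (set cs) q {})"
        by (cases s') (auto intro!: runs_Move[unfolded One_nat_def] simp: accepting_def picks_def)
    qed
  qed (use assms(1) in simp_all)
qed

section \<open>Four-coloring\<close>

lemma poly_nat_mono: "x \<le> y \<Longrightarrow> poly (p :: nat poly) x \<le> poly p y"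
  by (induction p) (auto intro!: add_mono mult_mono)

lemma nth_concat_uniform:
  assumes "\<And>xs. xs \<in> set xss \<Longrightarrow> length xs = n" "i < length xss" "j < n"
  shows "concat xss ! (i * n + j) = xss ! i ! j"
  using assms
proof (induction xss arbitrary: i)
  case (Cons xs xss)
  then show ?case by (cases i) (auto simp: nth_append)
qed simp

lemma length_adjacency_word: "length (adjacency_word G vs) = length vs * length vs"
  by (simp add: adjacency_word_def length_concat comp_def sum_list_triv)

lemma nth_adjacency_word:
  "u < length vs \<Longrightarrow> v < length vs \<Longrightarrow>
    adjacency_word G vs ! (u * length vs + v) \<longleftrightarrow> (vs ! u, vs ! v) \<in> parcs G"
  unfolding adjacency_word_def by (subst nth_concat_uniform) auto

text \<open>Vertices become their positions in \<open>vs\<close>, so that the loops of the program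
  range over exactly the vertex set and the word is the adjacency matrix of this graph.\<close>

definition index_graph :: "'a pair_pre_digraph \<Rightarrow> 'a list \<Rightarrow> nat \<Rightarrow> nat \<Rightarrow> bool" where
  "index_graph G vs u v \<longleftrightarrow> u < length vs \<and> v < length vs \<and> (vs ! u, vs ! v) \<in> parcs G"

lemma simple_graph_index_graph:
  assumes "pair_graph G"
  shows "simple_graph (index_graph G vs)"
proof -
  interpret pair_graph G by fact
  show ?thesis
    unfolding simple_graph_def index_graph_def using arcs_symmetric no_loops' by blast
qed

lemma induced_freeD:
  assumes "induced_free H G" "pair_graph G" "pair_graph H" "pverts H = {..<length us}"
    and us: "distinct us" "set us \<subseteq> pverts G"
    and adj: "\<And>i j. i < length us \<Longrightarrow> j < length us \<Longrightarrow> (i, j) \<in> parcs H \<longleftrightarrow> (us ! i, us ! j) \<in> parcs G"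
  shows False
proof -
  have "inj_on ((!) us) (pverts H)" using us(1) unfolding assms(4) by (simp add: inj_on_nth)
  moreover have "(!) us ` pverts H \<subseteq> pverts G" using us(2) unfolding assms(4) by auto
  ultimately show False
    using assms(1) adj unfolding induced_free_iff_no_embedding[OF assms(2,3)] assms(4) by blast
qed

lemma P6_free_index_graph:
  assumes G: "pair_graph G" "induced_free (path_graph 6) G" and vs: "distinct vs" "set vs = pverts G"
  shows "P6_free (index_graph G vs) {..<length vs}"
  unfolding P6_free_def
proof (intro ballI notI)
  fix a b c d e f
  assume V: "a \<in> {..<length vs}" "b \<in> {..<length vs}" "c \<in> {..<length vs}" "d \<in> {..<length vs}"
      "e \<in> {..<length vs}" "f \<in> {..<length vs}"
    and P: "induced_P6 (index_graph G vs) a b c d e f"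
  let ?E = "index_graph G vs"
  let ?is = "[a, b, c, d, e, f]"
  note graph = simple_graph_index_graph[OF G(1), of vs]
  have sym: "?E x y \<longleftrightarrow> ?E y x" for x y
    by (rule iffI) (rule simple_graph_sym[OF graph], assumption)+
  note irrefl = simple_graph_irrefl[OF graph]
  have adj: "(i, j) \<in> parcs (path_graph 6) \<longleftrightarrow> ?E (?is ! i) (?is ! j)" if "i < 6" "j < 6" for i j
  proof -
    have "i = 0 \<or> i = 1 \<or> i = 2 \<or> i = 3 \<or> i = 4 \<or> i = 5" "j = 0 \<or> j = 1 \<or> j = 2 \<or> j = 3 \<or> j = 4 \<or> j = 5"
      using that by arith+
    then show ?thesis
      by (elim disjE) (simp_all add: P[unfolded induced_P6_def] path_graph_def irrefl sym)
  qed
  have "distinct ?is" using P unfolding induced_P6_def by (auto simp: irrefl sym)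
  then have "distinct (map ((!) vs) ?is)" using V vs(1) by (simp add: nth_eq_iff_index_eq)
  moreover have "set (map ((!) vs) ?is) \<subseteq> pverts G"
    using V by (simp flip: vs(2))
  moreover have "(i, j) \<in> parcs (path_graph 6) \<longleftrightarrow>
      (map ((!) vs) ?is ! i, map ((!) vs) ?is ! j) \<in> parcs G" if "i < 6" "j < 6" for i j
  proof -
    have "?is ! i \<in> set ?is" "?is ! j \<in> set ?is" using that by (intro nth_mem; simp)+
    then have "?is ! i < length vs" "?is ! j < length vs" using V by auto
    then show ?thesis unfolding adj[OF that] using that by (simp add: index_graph_def del: list.map)
  qed
  ultimately show False
    by (intro induced_freeD[OF G(2,1) pair_graph_path_graph, of "map ((!) vs) ?is"])
      (auto simp: path_graph_def)
qed

lemma banner_free_index_graph: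
  assumes G: "pair_graph G" "induced_free banner G" and vs: "distinct vs" "set vs = pverts G"
  shows "banner_free (index_graph G vs) {..<length vs}"
  unfolding banner_free_def
proof (intro ballI notI)
  fix a b c d v
  let ?E = "index_graph G vs"
  assume V: "a \<in> {..<length vs}" "b \<in> {..<length vs}" "c \<in> {..<length vs}" "d \<in> {..<length vs}"
      "v \<in> {..<length vs}"
    and P: "a \<noteq> c \<and> b \<noteq> d \<and> ?E a b \<and> ?E b c \<and> ?E c d \<and> ?E d a \<and> \<not> ?E a c \<and> \<not> ?E b d \<and>
           ?E v a \<and> \<not> ?E v b \<and> \<not> ?E v c \<and> \<not> ?E v d"
  let ?is = "[a, b, c, d, v]"
  note graph = simple_graph_index_graph[OF G(1), of vs]
  have sym: "?E x y \<longleftrightarrow> ?E y x" for x y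
    by (rule iffI) (rule simple_graph_sym[OF graph], assumption)+
  note irrefl = simple_graph_irrefl[OF graph]
  note sym' = sym[of b a] sym[of c b] sym[of d c] sym[of a d] sym[of c a] sym[of d b]
    sym[of a v] sym[of b v] sym[of c v] sym[of d v]
  have adj: "(i, j) \<in> parcs banner \<longleftrightarrow> ?E (?is ! i) (?is ! j)" if "i < 5" "j < 5" for i j
  proof -
    have "i = 0 \<or> i = 1 \<or> i = 2 \<or> i = 3 \<or> i = 4" "j = 0 \<or> j = 1 \<or> j = 2 \<or> j = 3 \<or> j = 4"
      using that by arith+
    then show ?thesis
      by (elim disjE) (simp_all add: P parcs_banner irrefl sym')
  qed
  have "distinct ?is" using P by (auto simp: irrefl sym')
  then have "distinct (map ((!) vs) ?is)" using V vs(1) by (simp add: nth_eq_iff_index_eq)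
  moreover have "set (map ((!) vs) ?is) \<subseteq> pverts G"
    using V by (simp flip: vs(2))
  moreover have "(i, j) \<in> parcs banner \<longleftrightarrow>
      (map ((!) vs) ?is ! i, map ((!) vs) ?is ! j) \<in> parcs G" if "i < 5" "j < 5" for i j
  proof -
    have "?is ! i \<in> set ?is" "?is ! j \<in> set ?is" using that by (intro nth_mem; simp)+
    then have "?is ! i < length vs" "?is ! j < length vs" using V by auto
    then show ?thesis unfolding adj[OF that] using that by (simp add: index_graph_def del: list.map)
  qed
  ultimately show False
    by (intro induced_freeD[OF G(2,1) pair_graph_banner, of "map ((!) vs) ?is"])
      (auto simp: pverts_banner)
qed

lemma colorable_index_graph:
  assumes "pair_graph G" "distinct vs" "set vs = pverts G"
  shows "colorable k G \<longleftrightarrow> set_colorable (index_graph G vs) {..<length vs} {1..k}"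
proof
  assume "colorable k G"
  then obtain f where f: "\<forall>v\<in>pverts G. f v \<in> {1..k}" "\<forall>(u, v)\<in>parcs G. f u \<noteq> f v"
    unfolding colorable_def is_coloring_def by blast
  have "\<forall>v\<in>{..<length vs}. f (vs ! v) \<in> {1..k}"
    using f(1) assms(3) nth_mem by blast
  moreover have "\<forall>u v. index_graph G vs u v \<longrightarrow> f (vs ! u) \<noteq> f (vs ! v)"
    using f(2) unfolding index_graph_def by blast
  ultimately show "set_colorable (index_graph G vs) {..<length vs} {1..k}"
    unfolding set_colorable_def by (intro exI[of _ "\<lambda>v. f (vs ! v)"]) blast
next
  interpret pair_graph G by fact
  assume "set_colorable (index_graph G vs) {..<length vs} {1..k}"
  then obtain f where f: "\<And>v. v < length vs \<Longrightarrow> f v \<in> {1..k}"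
    "\<And>u v. u < length vs \<Longrightarrow> v < length vs \<Longrightarrow> index_graph G vs u v \<Longrightarrow> f u \<noteq> f v"
    unfolding set_colorable_def by blast
  define pos where "pos v = (SOME i. i < length vs \<and> vs ! i = v)" for v
  have pos: "pos v < length vs \<and> vs ! pos v = v" if "v \<in> pverts G" for v
    unfolding pos_def by (rule someI_ex) (use that assms(3) in \<open>simp flip: in_set_conv_nth\<close>)
  have "f (pos u) \<noteq> f (pos v)" if "(u, v) \<in> parcs G" for u v
  proof -
    have "u \<in> pverts G" "v \<in> pverts G" using that in_arcsD1 in_arcsD2 by blast+
    with pos that f(2) show ?thesis by (simp add: index_graph_def)
  qed
  then have "is_coloring k G (\<lambda>v. f (pos v))"
    using pos f(1) unfolding is_coloring_def by blast
  then show "colorable k G" unfolding colorable_def by blast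
qed

theorem theorem8:
  shows "poly_time_decidable_on
           (\<lambda>G. induced_free (path_graph 6) G \<and> induced_free banner G)
           (\<lambda>G. colorable 4 G)"
proof -
  obtain q where q: "\<forall>(E :: nat \<Rightarrow> nat \<Rightarrow> bool) W. finite W \<and> simple_graph E \<and> P6_free E W \<and>
      banner_free E W \<longrightarrow> (set_colorable E W {1..4::nat} \<longleftrightarrow> wins E W {1..4::nat} q {})"
    using colorable_iff_wins[OF finite_atLeastAtMost] ..
  let ?cs = "[1..<5] :: nat list"
  \<comment> \<open>Reading the size costs \<open>3 + 6 * n\<close> and the final move 1; the rest
    is the game.\<close>
  let ?p = "[:4, 6:] + play_time (length ?cs) q 0"
  have "\<exists>t s. exec (decide_coloring ?cs q) (initial_state (adjacency_word G vs)) t s \<and>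
      t \<le> poly ?p (length (adjacency_word G vs)) \<and> (accepting s \<longleftrightarrow> colorable 4 G)"
    if G: "pair_graph G" "induced_free (path_graph 6) G" "induced_free banner G"
      and vs: "distinct vs" "set vs = pverts G" for G :: "nat pair_pre_digraph" and vs
  proof -
    let ?n = "length vs" and ?E = "index_graph G vs"
    have "adjacency_word G vs ! (u * ?n + v) \<longleftrightarrow> ?E u v" if "u < ?n" "v < ?n" for u v
      using nth_adjacency_word[OF that] that by (simp add: index_graph_def)
    from decide_coloring_correct[OF length_adjacency_word this]
    obtain t s where run: "exec (decide_coloring ?cs q) (initial_state (adjacency_word G vs)) t s"
      and t: "t \<le> 3 + ?n * 6 + (poly (play_time (length ?cs) q 0) ?n + 1)"
      and acc: "accepting s \<longleftrightarrow> wins ?E {..<?n} (set ?cs) q {}"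
      unfolding runs_def by blast
    have "t \<le> poly ?p ?n" using t by simp
    \<comment> \<open>The time is bounded in terms of the number \<open>n\<close> of vertices, but
      the input has length \<open>n * n\<close>. Natural coefficients make the polynomial monotone,
      so \<open>n \<le> n * n\<close> suffices.\<close>
    also have "\<dots> \<le> poly ?p (length (adjacency_word G vs))"
      unfolding length_adjacency_word by (intro poly_nat_mono le_square)
    finally have bound: "t \<le> poly ?p (length (adjacency_word G vs))" .
    have "set ?cs = {1..4}" by auto
    moreover have "set_colorable ?E {..<?n} {1..4::nat} \<longleftrightarrow> wins ?E {..<?n} {1..4::nat} q {}"
      using simple_graph_index_graph[OF G(1)] P6_free_index_graph[OF G(1,2) vs]
        banner_free_index_graph[OF G(1,3) vs] by (intro q[rule_format]) simp
    ultimately have "accepting s \<longleftrightarrow> colorable 4 G"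
      unfolding acc colorable_index_graph[OF G(1) vs] by simp
    then show ?thesis using run bound by blast
  qed
  then show ?thesis unfolding poly_time_decidable_on_def by blast
qed

end
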